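(* Let $q$ range over prime powers with $q\equiv 1\pmod 4$, and let $r=r(q)$ be a positive integer with $r\to\infty$ and $r/q^{1/4}\to 0$ as $q\to\infty$. Let $N_r$ denote the number of subsets $S\subseteq\mathbb{F}_q$ with $|S|=r$ such that the induced subgraph $P_q[S]$ of the Paley graph is even. Then $$N_r=(1+o(1))\,2^{1-r}\binom{q}{r}\quad\text{as } q\to\infty.$$
   Context: For $q\equiv 1\pmod 4$ a prime power, the Paley graph $P_q$ has vertex set $\mathbb{F}_q$, with $x,y$ adjacent iff $x-y$ is a nonzero square in $\mathbb{F}_q$. An induced subgraph is even if every vertex has even degree in it. *)

theory Defs
  imports
    "HOL-Algebra.Ring"
    "HOL-Number_Theory.Cong"
    "HOL-Number_Theory.Prime_Powers"
    "HOL-Library.Landau_Symbols"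
begin

text \<open>A graph is a vertex set together with a set of edges, each edge being the set of
  its two endpoints.\<close>

type_synonym 'a graph = "'a set \<times> 'a set set"

definition induced_subgraph :: "'a graph \<Rightarrow> 'a set \<Rightarrow> 'a graph" where
  "induced_subgraph G S = (S, {e \<in> snd G. e \<subseteq> S})"

definition graph_degree :: "'a graph \<Rightarrow> 'a \<Rightarrow> nat" where
  "graph_degree G v = card {e \<in> snd G. v \<in> e}"

definition even_graph :: "'a graph \<Rightarrow> bool" where
  "even_graph G \<longleftrightarrow> (\<forall>v \<in> fst G. even (graph_degree G v))"

definition nonzero_squares :: "('a, 'b) ring_scheme \<Rightarrow> 'a set" where
  "nonzero_squares F = {z [^]\<^bsub>F\<^esub> (2::nat) | z. z \<in> carrier F} - {\<zero>\<^bsub>F\<^esub>}"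

text \<open>If the field has order congruent to 1 modulo 4, then \<open>-1\<close> is a square, so whether
  \<open>x\<close> and \<open>y\<close> are adjacent does not depend on their order.\<close>

definition paley_graph :: "('a, 'b) ring_scheme \<Rightarrow> 'a graph" where
  "paley_graph F =
     (carrier F,
      {{x, y} | x y. x \<in> carrier F \<and> y \<in> carrier F \<and> x \<ominus>\<^bsub>F\<^esub> y \<in> nonzero_squares F})"

definition num_even_induced :: "('a, 'b) ring_scheme \<Rightarrow> nat \<Rightarrow> nat" where
  "num_even_induced F r =
     card {S. S \<subseteq> carrier F \<and> card S = r \<and> even_graph (induced_subgraph (paley_graph F) S)}"

definition paley_orders :: "nat set" where
  "paley_orders = {q. primepow q \<and> [q = 1] (mod 4)}"

text \<open>The filter for \<open>q\<close> tending to infinity through the orders of Paley graphs.\<close>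

definition paley_at_top :: "nat filter" where
  "paley_at_top = inf at_top (principal paley_orders)"

end

theory Submission
  imports
    "HOL-Library.Cardinality"
    "HOL-Computational_Algebra.Computational_Algebra"
    "HOL-Algebra.Weak_Morphisms"
    Defs
begin

text \<open>
  Let \<open>\<chi>\<close> be the quadratic character. A set \<open>S\<close> of size \<open>r\<close> induces an even subgraph iff
  \<open>\<Prod>u\<in>S - {v}. \<chi> (v - u)\<close> equals \<open>(-1)^(r-1)\<close> for all \<open>v \<in> S\<close>. Expanding the product of the \<open>r\<close> indicator
  functions gives \<open>2^(-r)\<close> times a sum over \<open>T \<subseteq> S\<close> of \<open>\<plusminus> \<Prod> \<chi> (v - u)\<close> over \<open>v \<in> T\<close>, \<open>u \<in> S - T\<close>, since
  the pairs inside \<open>T\<close> cancel. The choices \<open>T = {}\<close> and \<open>T = S\<close> give the main term. In the other terms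
  the larger of the two parts runs over the \<open>t\<close>-subsets of the field while the smaller part \<open>U\<close> is fixed, so one gets
  an elementary symmetric function of the signs \<open>\<chi> (\<Prod>u\<in>U. v - u)\<close>, i.e. a coefficient of
  \<open>(1 + z)^a (1 - z)^b\<close>. It is exponentially small in \<open>t\<close> relative to the number of \<open>t\<close>-subsets as soon as
  \<open>\<bar>a - b\<bar> \<le> q / 288\<close>.

  This weak form of Weil's bound for \<open>y\<^sup>2 = f(x)\<close>, \<open>f = \<Prod>u\<in>U. X - u\<close>, comes from Stepanov's method: a nonzero
  polynomial \<open>\<Sum>j. (r\<^sub>j + s\<^sub>j f^((q-1)/2)) X^(qj)\<close> is constructed by counting coefficients so that it vanishes to high order at
  all points where \<open>f^((q-1)/2)\<close> takes a prescribed value \<open>\<plusminus>1\<close>.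
\<close>

hide_const (open) Coset.order

section \<open>Hasse derivatives\<close>

text \<open>\<open>taylor h\<close> is \<open>h(X + Y)\<close>, a polynomial in the outer variable \<open>Y\<close> with coefficients in
  the polynomials in \<open>X\<close>; in small characteristic its coefficients replace the higher derivatives divided by factorials.\<close>

definition taylor :: "'a::comm_ring_1 poly \<Rightarrow> 'a poly poly" where
  "taylor h = poly (map_poly (\<lambda>c. [:[:c:]:]) h) [:[:0, 1:], 1:]"

definition hasse :: "nat \<Rightarrow> 'a::comm_ring_1 poly \<Rightarrow> 'a poly" where
  "hasse k h = coeff (taylor h) k"

lemma taylor_0 [simp]: "taylor 0 = 0"
  by (simp add: taylor_def)

lemma taylor_pCons: "taylor (pCons c h) = [:[:c:]:] + [:[:0, 1:], 1:] * taylor h"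
  by (cases "c = 0 \<and> h = 0") (auto simp: taylor_def map_poly_pCons)

lemma taylor_add: "taylor (p + q) = taylor p + taylor q"
proof (induction p q rule: poly_induct2)
  case (pCons a p b q)
  have *: "[:[:a + b:]:] = [:[:a:]:] + [:[:b:]:]" by simp
  show ?case
    by (simp only: add_pCons[of a p b q] taylor_pCons pCons.IH distrib_left * add_ac)
qed simp

lemma taylor_smult: "taylor (smult c p) = smult [:c:] (taylor p)"
  by (induction p) (simp_all add: taylor_pCons algebra_simps smult_add_right)

lemma taylor_mult: "taylor (p * q) = taylor p * taylor q"
proof (induction p)
  case (pCons a p)
  have "taylor (pCons a p * q) = smult [:a:] (taylor q) + [:[:0, 1:], 1:] * (taylor p * taylor q)"
    by (simp only: mult_pCons_left taylor_add taylor_smult taylor_pCons pCons.IH) simp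
  also have "\<dots> = taylor (pCons a p) * taylor q"
    by (simp only: taylor_pCons distrib_right mult.assoc) simp
  finally show ?case .
qed simp

lemma hasse_0_right [simp]: "hasse k 0 = 0"
  by (simp add: hasse_def)

lemma hasse_add: "hasse k (p + q) = hasse k p + hasse k q"
  by (simp add: hasse_def taylor_add)

lemma hasse_smult: "hasse k (smult c p) = smult c (hasse k p)"
  by (simp add: hasse_def taylor_smult)

lemma hasse_diff: "hasse k (p - q) = hasse k p - hasse k q"
  using hasse_add[of k "p - q" q] by simp

lemma hasse_sum: "hasse k (\<Sum>i\<in>I. g i) = (\<Sum>i\<in>I. hasse k (g i))"
  by (induction I rule: infinite_finite_induct) (simp_all add: hasse_add)

text \<open>The Leibniz rule without binomial factors: the substitution \<open>h(X + Y)\<close> is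
  multiplicative, so coefficients of \<open>Y\<close> are convolved.\<close>

lemma hasse_mult: "hasse k (p * q) = (\<Sum>i\<le>k. hasse i p * hasse (k - i) q)"
  by (simp add: hasse_def taylor_mult coeff_mult)

lemma hasse_pCons:
  "hasse k (pCons c h) = (if k = 0 then [:c:] else hasse (k - 1) h) + pCons 0 (hasse k h)"
  by (cases k) (simp_all add: hasse_def taylor_pCons)

lemma hasse_0 [simp]: "hasse 0 p = p"
  by (induction p) (simp_all add: hasse_pCons)

lemma degree_hasse_le: "degree (hasse k p) \<le> degree p"
proof (induction p arbitrary: k)
  case (pCons a p)
  show ?case
  proof (cases "p = 0")
    case False
    then have "degree (pCons 0 (hasse k p)) \<le> Suc (degree p)" for k
      using degree_pCons_le[of 0 "hasse k p"] pCons.IH[of k] by linarith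
    moreover have "degree (if k = 0 then [:a:] else hasse (k - 1) p) \<le> Suc (degree p)"
      using pCons.IH[of "k - 1"] by auto
    ultimately show ?thesis
      unfolding hasse_pCons degree_pCons_eq[OF False] by (intro degree_add_le)
  qed (simp add: hasse_pCons)
qed simp

text \<open>Evaluated at a point, Hasse derivatives are the coefficients of the expansion around
  that point.\<close>

lemma poly_hasse: "poly (hasse k p) x = coeff (pcompose p [:x, 1:]) k"
proof (induction p arbitrary: k)
  case (pCons a p)
  then show ?case
    by (cases k) (simp_all add: hasse_pCons pcompose_pCons)
qed simp

lemma pcompose_power: "pcompose (p ^ n) r = pcompose p r ^ n"
  for p :: "'a::comm_ring_1 poly"
  by (induction n) (simp_all add: pcompose_mult pcompose_1)

text \<open>In any characteristic, the first \<open>m\<close> Taylor coefficients at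
  \<open>x\<close> vanish exactly when the shifted polynomial is divisible by \<open>X^m\<close>;
  shifting back gives the factor.\<close>

lemma power_dvd_if_hasse_zero:
  fixes p :: "'a::field poly"
  assumes "\<And>k. k < m \<Longrightarrow> poly (hasse k p) x = 0"
  shows "[:- x, 1:] ^ m dvd p"
proof -
  have "monom 1 m dvd pcompose p [:x, 1:]"
    unfolding monom_1_dvd_iff' using assms by (simp add: poly_hasse)
  then obtain r where r: "pcompose p [:x, 1:] = monom 1 m * r" ..
  have "p = pcompose (pcompose p [:x, 1:]) [:- x, 1:]"
    by (simp add: pcompose_assoc[symmetric] pcompose_pCons)
  also have "\<dots> = [:- x, 1:] ^ m * pcompose r [:- x, 1:]"
    unfolding r monom_altdef by (simp add: pcompose_mult pcompose_smult pcompose_power pcompose_pCons)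
  finally show ?thesis by (metis dvd_triv_left)
qed

text \<open>One factor \<open>f\<close> is peeled off at a time. In the Leibniz sum either it is
  left undifferentiated, or it absorbs at least one of the \<open>k\<close> derivatives. For
  \<open>k > n\<close> truncated subtraction makes the claim trivial.\<close>

lemma power_dvd_hasse: "f ^ (n - k) dvd hasse k (f ^ n * h)"
proof (induction n arbitrary: k)
  case (Suc n)
  have "f ^ (Suc n - k) dvd hasse i f * hasse (k - i) (f ^ n * h)" if "i \<le> k" for i
  proof (cases i)
    case 0
    have "f ^ (Suc n - k) dvd f * f ^ (n - k)"
      unfolding power_Suc[symmetric] by (rule le_imp_power_dvd) simp
    then show ?thesis using 0 Suc[of k] by (simp add: dvd_trans mult_dvd_mono)
  next
    case (Suc j)
    have "f ^ (Suc n - k) dvd f ^ (n - (k - i))"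
      using Suc that by (intro le_imp_power_dvd) simp
    then show ?thesis using Suc.IH[of "k - i"] by (meson dvd_mult dvd_trans)
  qed
  then show ?case
    unfolding power_Suc mult.assoc hasse_mult by (intro dvd_sum) simp
qed simp

lemma card_mult_le_degree:
  fixes p :: "'a::field poly"
  assumes "p \<noteq> 0" "finite B" "\<And>x. x \<in> B \<Longrightarrow> [:- x, 1:] ^ m dvd p"
  shows "m * card B \<le> degree p"
proof -
  have "m * card B = (\<Sum>x\<in>B. m)" by simp
  also have "\<dots> \<le> (\<Sum>x\<in>B. count (proots p) x)"
    using assms by (intro sum_mono) (simp add: order_divides)
  also have "\<dots> \<le> (\<Sum>x\<in>B \<union> set_mset (proots p). count (proots p) x)"
    using assms by (intro sum_mono2) (auto simp: poly_roots_finite)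
  also have "\<dots> = size (proots p)"
    unfolding size_multiset_overloaded_eq
    using assms by (intro sum.mono_neutral_right) (auto simp: poly_roots_finite order_gt_0_iff)
  also have "\<dots> \<le> degree p" by (rule size_proots_le)
  finally show ?thesis .
qed

section \<open>Polynomials with prescribed roots over a finite field\<close>

definition root_poly :: "'a::field set \<Rightarrow> 'a poly" where
  "root_poly U = (\<Prod>u\<in>U. [:- u, 1:])"

text \<open>Bounding coefficients instead of the degree lets the case \<open>m = 0\<close> contain
  just the zero polynomial, so the cardinality is a pure power for every \<open>m\<close>.\<close>

definition polys_below :: "nat \<Rightarrow> 'a::zero poly set" where
  "polys_below m = {p. \<forall>i\<ge>m. coeff p i = 0}"

lemma polys_below_iff:
  assumes "m > 0"
  shows "p \<in> polys_below m \<longleftrightarrow> degree p < m"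
proof
  assume "p \<in> polys_below m"
  then have "degree p \<le> m - 1"
    using assms by (intro degree_le) (auto simp: polys_below_def)
  then show "degree p < m" using assms by linarith
qed (auto simp: polys_below_def coeff_eq_0)

lemma bij_betw_polys_below:
  "bij_betw (\<lambda>p. restrict (coeff p) {..<m}) (polys_below m) ({..<m} \<rightarrow>\<^sub>E (UNIV :: 'a::zero set))"
proof (rule bij_betw_byWitness[where f' = "\<lambda>c. Poly (map c [0..<m])"])
  show "\<forall>p\<in>polys_below m. Poly (map (restrict (coeff p) {..<m}) [0..<m]) = p"
    by (auto simp: polys_below_def poly_eq_iff nth_default_def)
  show "\<forall>c\<in>{..<m} \<rightarrow>\<^sub>E UNIV. restrict (coeff (Poly (map c [0..<m]))) {..<m} = c"
    by (auto simp: fun_eq_iff nth_default_def PiE_def extensional_def)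
  show "(\<lambda>p. restrict (coeff p) {..<m}) ` polys_below m \<subseteq> {..<m} \<rightarrow>\<^sub>E UNIV"
    by (simp add: image_subset_iff restrict_PiE_iff)
  show "(\<lambda>c. Poly (map c [0..<m])) ` ({..<m} \<rightarrow>\<^sub>E UNIV) \<subseteq> polys_below m"
    by (simp add: image_subset_iff polys_below_def nth_default_def)
qed

lemma card_polys_below: "card (polys_below m :: 'a::{zero,finite} poly set) = CARD('a) ^ m"
  using bij_betw_same_card[OF bij_betw_polys_below[of m, where ?'a = 'a]] by (simp add: card_PiE)

lemma finite_polys_below: "finite (polys_below m :: 'a::{zero,finite} poly set)"
  using bij_betw_finite[OF bij_betw_polys_below[of m, where ?'a = 'a]] by (simp add: finite_PiE)

text \<open>Both sides are monic of degree \<open>CARD('a)\<close> and agree at all points of the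
  field. Their difference thus has more roots than its degree allows unless it is zero.\<close>

lemma linear_power_card: "[:- u, 1:] ^ CARD('a) = monom 1 CARD('a) - [:u:]"
  for u :: "'a::finite_field"
proof (rule ccontr)
  let ?q = "CARD('a)"
  let ?D = "[:- u, 1:] ^ ?q - (monom 1 ?q - [:u:])"
  assume "[:- u, 1:] ^ ?q \<noteq> monom 1 ?q - [:u:]"
  then have D: "?D \<noteq> 0" by simp
  have q: "?q > 0" by simp
  have "degree ([:- u, 1:] ^ ?q) = ?q"
    by (simp add: degree_linear_power)
  then have "degree ?D \<le> ?q"
    by (intro degree_diff_le) (auto simp: degree_monom_le)
  moreover have "coeff ?D ?q = 0"
    using q by (simp add: coeff_linear_power coeff_pCons split: nat.split)
  ultimately have "degree ?D < ?q"
    using D by (metis leading_coeff_0_iff le_neq_implies_less)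
  moreover have "{x. poly ?D x = 0} = UNIV"
    using finite_field_power_card_eq_same[where 'a = 'a] by (auto simp: poly_monom)
  ultimately show False
    using card_poly_roots_bound[OF D] by simp
qed

section \<open>Polynomials with simple roots, and relations modulo \<open>X^q\<close>\<close>

lemma degree_root_poly: "degree (root_poly U) = card U"
  by (cases "finite U") (simp_all add: root_poly_def degree_prod_eq_sum_degree)

lemma root_poly_nonzero [simp]: "root_poly U \<noteq> 0"
  by (cases "finite U") (simp_all add: root_poly_def)

lemma poly_root_poly: "poly (root_poly U) x = (\<Prod>u\<in>U. x - u)"
  by (simp add: root_poly_def poly_prod)

lemma order_root_poly:
  assumes "finite U" "u \<in> U"
  shows "order u (root_poly U) = 1"
proof -
  have *: "root_poly U = [:- u, 1:] * root_poly (U - {u})"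
    using assms by (simp add: root_poly_def prod.remove)
  have "order u (root_poly (U - {u})) = 0"
    using assms by (intro order_0I) (simp add: poly_root_poly)
  moreover have "order u [:- u, 1:] = 1"
    using order_power_n_n[of u 1] by simp
  ultimately show ?thesis
    unfolding * by (subst order_mult) (simp_all only: mult_eq_0_iff root_poly_nonzero, simp_all)
qed

text \<open>By the Frobenius identity for each linear factor, \<open>f^q = f(X^q)\<close>; modulo
  \<open>X^q\<close> only the constant term survives.\<close>

lemma root_poly_power_card:
  fixes U :: "'a::finite_field set"
  shows "monom 1 CARD('a) dvd root_poly U ^ CARD('a) - [:poly (root_poly U) 0:]"
proof -
  have "root_poly U ^ CARD('a) = pcompose (root_poly U) (monom 1 CARD('a))"
  proof -
    have "[:- u, 1:] ^ CARD('a) = pcompose [:- u, 1:] (monom 1 CARD('a))" for u :: 'a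
      using minus_pCons[of u 0] unfolding linear_power_card by (simp add: pcompose_pCons)
    then show ?thesis
      by (simp add: root_poly_def prod_power_distrib pcompose_prod)
  qed
  also obtain c h where "root_poly U = pCons c h" by (cases "root_poly U")
  finally show ?thesis
    using \<open>root_poly U = pCons c h\<close> by (simp add: pcompose_pCons)
qed

lemma poly_dvd_imp_eq:
  fixes p :: "'a::field poly"
  assumes "monom 1 m dvd p - r" "degree p < m" "degree r < m"
  shows "p = r"
proof (rule ccontr)
  assume "p \<noteq> r"
  then have "m \<le> degree (p - r)"
    using dvd_imp_degree_le[OF assms(1)] by (simp add: degree_monom_eq)
  then show False using degree_diff_less[of p m r] assms by simp
qed

lemma order_monom_dvd: "monom 1 m dvd p \<Longrightarrow> p \<noteq> 0 \<Longrightarrow> m \<le> order 0 p"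
  for p :: "'a::field poly"
  using order_divides[of 0 m p] by (simp add: monom_altdef)

lemma order_power: "p \<noteq> 0 \<Longrightarrow> order a (p ^ n) = n * order a p"
  for p :: "'a::field poly"
  by (induction n) (simp_all add: order_mult)

text \<open>Multiplying by \<open>f (r - s f\<^sup>n)\<close> turns the hypothesis into \<open>r\<^sup>2 f = f(0) s\<^sup>2\<close>
  modulo \<open>X\<^sup>q\<close>, and degrees make this an identity; the simple roots of \<open>f\<close> then contradict the parity
  of the order of vanishing.\<close>

lemma no_small_relation:
  fixes U :: "'a::finite_field set" and r s :: "'a poly"
  assumes odd: "odd CARD('a)" and U: "U \<noteq> {}"
    and n: "n = (CARD('a) - 1) div 2"
    and deg: "2 * degree r + card U < CARD('a)" "2 * degree s + card U < CARD('a)"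
    and dvd: "monom 1 CARD('a) dvd r + root_poly U ^ n * s"
  shows "r = 0 \<and> s = 0"
proof -
  let ?q = "CARD('a)"
  define f where "f = root_poly U"
  define c where "c = poly f 0"
  have f: "f \<noteq> 0" by (simp add: f_def)
  have qn: "?q = Suc (2 * n)" using odd n by (auto elim!: oddE)
  have fq: "f ^ ?q = f * (f ^ n * f ^ n)"
    unfolding qn by (simp add: power_add[symmetric] mult_2)
  have ring_identity: "(r + g * s) * (f * (r - g * s)) + s ^ 2 * (f * (g * g) - h) = r ^ 2 * f - h * s ^ 2"
    for g h :: "'a poly"
    by (simp add: algebra_simps power2_eq_square)
  have "(r + f ^ n * s) * (f * (r - f ^ n * s)) + s ^ 2 * (f ^ ?q - [:c:]) = r ^ 2 * f - [:c:] * s ^ 2"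
    unfolding fq by (rule ring_identity)
  moreover have "monom 1 ?q dvd (r + f ^ n * s) * (f * (r - f ^ n * s)) + s ^ 2 * (f ^ ?q - [:c:])"
    using dvd root_poly_power_card[of U] unfolding f_def c_def
    by (rule dvd_add[OF dvd_mult2 dvd_mult])
  ultimately have "monom 1 ?q dvd r ^ 2 * f - smult c (s ^ 2)"
    by (simp only: mult_pCons_left mult_zero_left pCons_0_0 add_0_right)
  moreover have "degree (r ^ 2 * f) < ?q"
    using deg degree_mult_le[of "r ^ 2" f] degree_power_le[of r 2] by (simp add: f_def degree_root_poly)
  moreover have "degree (smult c (s ^ 2)) < ?q"
    using deg degree_smult_le[of c "s ^ 2"] degree_power_le[of s 2] by linarith
  ultimately have eq: "r ^ 2 * f = smult c (s ^ 2)" by (rule poly_dvd_imp_eq)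
  show ?thesis
  proof (cases "c = 0")
    case True
    then have r: "r = 0" using eq f by simp
    \<comment> \<open>Here \<open>f\<close> has a simple root at 0, so \<open>f ^ n * s\<close>
      vanishes there to order \<open>n\<close> plus the order of \<open>s\<close>. Order at least
      \<open>q = 2 * n + 1\<close> would force \<open>degree s > n\<close>.\<close>
    have "s = 0"
    proof (rule ccontr)
      assume s: "s \<noteq> 0"
      have "0 \<in> U" using True by (auto simp: c_def f_def poly_root_poly)
      have "?q \<le> order 0 (f ^ n * s)"
        using dvd r s f by (intro order_monom_dvd) (auto simp: f_def)
      also have "\<dots> = n + order 0 s"
        using s f order_root_poly[OF _ \<open>0 \<in> U\<close>] by (simp add: order_mult order_power f_def)
      also have "\<dots> \<le> n + degree s" using s by (simp add: order_degree)
      finally show False using deg qn by linarith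
    qed
    then show ?thesis using r by simp
  next
    case False
    obtain u where u: "u \<in> U" using U by blast
    have "r = 0"
    proof (rule ccontr)
      assume r: "r \<noteq> 0"
      then have s: "s \<noteq> 0" using eq f by auto
      have "order u (r ^ 2 * f) = 2 * order u r + 1"
        using r f order_root_poly[OF _ u] by (simp add: order_mult order_power f_def)
      moreover have "order u (smult c (s ^ 2)) = 2 * order u s"
        using False s by (simp add: order_smult order_power)
      ultimately have "2 * order u r + 1 = 2 * order u s" using eq by simp
      then show False by presburger
    qed
    then show ?thesis using eq False by simp
  qed
qed

section \<open>Stepanov's method\<close>

lemma diff_dvd_power_diff: "x - y dvd x ^ n - y ^ n"
  for x y :: "'a::comm_ring_1"
proof (induction n)
  case (Suc n)
  have "x ^ Suc n - y ^ Suc n = x * (x ^ n - y ^ n) + (x - y) * y ^ n"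
    by (simp add: algebra_simps)
  then show ?case using Suc by (metis dvd_add dvd_mult dvd_triv_left)
qed simp

text \<open>The blocks are eliminated from the lowest power upwards: once those below
  \<open>j\<close> vanish, dividing by the \<open>j\<close>-th power of \<open>X^q\<close> shows
  that block \<open>j\<close> is zero modulo \<open>X^q\<close>, and
  \<open>no_small_relation\<close> applies.\<close>

lemma auxiliary_poly_nonzero:
  fixes U :: "'a::finite_field set" and r s :: "nat \<Rightarrow> 'a poly"
  assumes odd: "odd CARD('a)" and U: "U \<noteq> {}"
    and n: "n = (CARD('a) - 1) div 2"
    and deg: "\<And>j. j < J \<Longrightarrow> 2 * degree (r j) + card U < CARD('a)"
      "\<And>j. j < J \<Longrightarrow> 2 * degree (s j) + card U < CARD('a)"
    and zero: "(\<Sum>j<J. (r j + root_poly U ^ n * s j) * monom 1 CARD('a) ^ j) = 0"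
    and j: "j < J"
  shows "r j = 0 \<and> s j = 0"
  using j
proof (induction j rule: less_induct)
  case (less j)
  let ?X = "monom 1 CARD('a) :: 'a poly"
  define w where "w = (\<lambda>j. r j + root_poly U ^ n * s j)"
  have "(\<Sum>i<J. w i * ?X ^ i) = (\<Sum>i\<in>{j..<J}. w i * ?X ^ i)"
    using less.IH less.prems by (intro sum.mono_neutral_right) (auto simp: w_def)
  also have "\<dots> = w j * ?X ^ j + (\<Sum>i\<in>{Suc j..<J}. w i * ?X ^ i)"
    using less.prems by (rule sum.atLeast_Suc_lessThan)
  finally have *: "w j * ?X ^ j + (\<Sum>i\<in>{Suc j..<J}. w i * ?X ^ i) = 0"
    using zero by (simp add: w_def)
  have "?X ^ Suc j dvd (\<Sum>i\<in>{Suc j..<J}. w i * ?X ^ i)"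
    by (intro dvd_sum dvd_mult le_imp_power_dvd) simp
  moreover have "w j * ?X ^ j = - (\<Sum>i\<in>{Suc j..<J}. w i * ?X ^ i)"
    using * by (rule eq_neg_iff_add_eq_0[THEN iffD2])
  ultimately have "?X * ?X ^ j dvd w j * ?X ^ j" by simp
  then have "?X dvd w j"
    by (subst (asm) dvd_mult_cancel_right) (simp add: monom_eq_0_iff)
  then show ?case
    using no_small_relation[OF odd U n, of "r j" "s j"] deg less.prems by (simp add: w_def)
qed

text \<open>\<open>A\<close> bounds the degrees of the unknown \<open>r j\<close> and
  \<open>s j\<close>, \<open>J\<close> is the number of blocks and \<open>M\<close> the order of
  vanishing. The hypothesis \<open>count\<close> says that there are more free coefficients than
  linear conditions; the conclusion compares the number of zeros with the degree of the auxiliary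
  polynomial.\<close>

lemma stepanov_bound:
  fixes U :: "'a::finite_field set" and \<sigma> :: 'a
  assumes odd: "odd CARD('a)" and U: "U \<noteq> {}"
    and n: "n = (CARD('a) - 1) div 2" and \<sigma>: "\<sigma> \<noteq> 0"
    and A: "A > 0" "2 * A + card U \<le> CARD('a) + 1"
    and M: "M \<le> n"
    and count: "M * (J + A + M * card U) < 2 * A * J"
  shows "M * card {x. poly (root_poly U) x ^ n = \<sigma>} \<le> A + n * card U + J * CARD('a)"
proof -
  let ?q = "CARD('a)"
  let ?X = "monom 1 ?q :: 'a poly"
  define d where "d = card U"
  define f where "f = root_poly U"
  define B where "B = J + A + M * d"
  have deg_f: "degree f = d" by (simp add: f_def d_def degree_root_poly)
  have f0: "f \<noteq> 0" by (simp add: f_def)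
  have q2: "?q \<ge> 2"
    using card_mono[of UNIV "{0, 1 :: 'a}"] by simp
  have J: "J > 0" using count by (cases J) auto
  \<comment> \<open>The division is exact by \<open>power_dvd_hasse\<close> and leaves a quotient of
    small degree, in which the large exponent \<open>n\<close> has disappeared.\<close>
  define P where "P = (\<lambda>k s. hasse k (f ^ n * s) div f ^ (n - k))"
  have P: "hasse k (f ^ n * s) = f ^ (n - k) * P k s" for k s
    using power_dvd_hasse[of f n k s] by (simp add: P_def)
  have P_diff: "P k (s - s') = P k s - P k s'" for k s s'
    by (simp add: P_def right_diff_distrib hasse_diff poly_div_diff_left)
  have deg_P: "degree (P k s) \<le> degree s + k * d" if "k \<le> n" for k s
  proof (cases "P k s = 0")
    case False
    have "(n - k) * d + degree (P k s) = degree (hasse k (f ^ n * s))"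
      unfolding P using False f0 by (simp add: degree_mult_eq degree_power_eq deg_f)
    also have "\<dots> \<le> degree (f ^ n * s)" by (rule degree_hasse_le)
    also have "\<dots> \<le> n * d + degree s"
      using degree_mult_le[of "f ^ n" s] f0 by (simp add: degree_power_eq deg_f)
    also have "n * d = (n - k) * d + k * d" using that by (simp flip: add_mult_distrib)
    finally show ?thesis by simp
  qed simp
  \<comment> \<open>At a point \<open>x\<close> with \<open>f(x)^n = \<sigma>\<close> one has
    \<open>x^q = x\<close>. Hence \<open>f^k\<close> times the \<open>k\<close>-th Hasse derivative
    of the auxiliary polynomial takes the same value as this polynomial of low degree.\<close>
  define L where "L = (\<lambda>(r, s) k.
    \<Sum>j<J. monom 1 j * (f ^ k * hasse k (r j) + smult \<sigma> (P k (s j))))"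
  define V where "V = ({..<J} \<rightarrow>\<^sub>E (polys_below A :: 'a poly set)) \<times> ({..<J} \<rightarrow>\<^sub>E (polys_below A :: 'a poly set))"
  define W where "W = {..<M} \<rightarrow>\<^sub>E (polys_below B :: 'a poly set)"
  have "L v k \<in> polys_below B" if v: "v \<in> V" and k: "k < M" for v k
  proof -
    obtain r s where rs: "v = (r, s)" by force
    have "degree (monom 1 j * (f ^ k * hasse k (r j) + smult \<sigma> (P k (s j)))) \<le> B - 1" if j: "j < J" for j
    proof -
      have deg: "degree (r j) < A" "degree (s j) < A"
        using v j A by (auto simp: V_def rs PiE_iff polys_below_iff)
      have kd: "k * d \<le> M * d" using k by simp
      have fk: "degree (f ^ k) = k * d" using f0 by (simp add: degree_power_eq deg_f)
      have "degree (f ^ k * hasse k (r j)) \<le> A - 1 + M * d"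
        using degree_mult_le[of "f ^ k" "hasse k (r j)"] degree_hasse_le[of k "r j"] deg kd
        unfolding fk by linarith
      moreover have "degree (smult \<sigma> (P k (s j))) \<le> A - 1 + M * d"
        using deg_P[of k "s j"] degree_smult_le[of \<sigma> "P k (s j)"] deg kd k M by linarith
      ultimately have "degree (f ^ k * hasse k (r j) + smult \<sigma> (P k (s j))) \<le> A - 1 + M * d"
        by (rule degree_add_le)
      then show ?thesis
        using degree_mult_le[of "monom 1 j" "f ^ k * hasse k (r j) + smult \<sigma> (P k (s j))"] j
        by (simp add: degree_monom_eq B_def)
    qed
    then have "degree (L v k) \<le> B - 1"
      unfolding L_def rs by (auto intro!: degree_sum_le)
    then show ?thesis using J by (subst polys_below_iff) (auto simp: B_def)
  qed
  then have into: "(\<lambda>v. restrict (L v) {..<M}) ` V \<subseteq> W"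
    by (simp add: W_def image_subset_iff restrict_PiE_iff)
  \<comment> \<open>Pigeonhole: \<open>M\<close> conditions with \<open>B\<close> coefficients each,
    against \<open>2 * A * J\<close> free coefficients.\<close>
  have "card W = ?q ^ (M * B)"
    by (simp add: W_def card_PiE card_polys_below power_mult[symmetric] mult.commute)
  also have "\<dots> < ?q ^ (2 * A * J)"
    using count q2 by (intro power_strict_increasing) (simp_all add: B_def d_def)
  also have "\<dots> = card V"
    using power_add[of ?q "A * J" "A * J"]
    by (simp add: V_def card_cartesian_product card_PiE card_polys_below mult_2 distrib_right
        flip: power_mult)
  finally have "card W < card V" .
  then have "\<not> inj_on (\<lambda>v. restrict (L v) {..<M}) V"
    using into card_inj_on_le[of _ V W] by (auto simp: W_def finite_PiE finite_polys_below)
  then obtain r s r' s' where rs: "(r, s) \<in> V" "(r', s') \<in> V" "(r, s) \<noteq> (r', s')"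
    and eq: "restrict (L (r, s)) {..<M} = restrict (L (r', s')) {..<M}"
    by (fastforce simp: inj_on_def)
  \<comment> \<open>\<open>L\<close> is additive, so the difference of two colliding pairs is a
    nonzero pair annihilated by all conditions.\<close>
  define R where "R = (\<lambda>j. r j - r' j)"
  define S where "S = (\<lambda>j. s j - s' j)"
  have deg: "degree (R j) < A" "degree (S j) < A" if "j < J" for j
    using rs that A by (auto simp: V_def R_def S_def PiE_iff polys_below_iff intro!: degree_diff_less)
  obtain j0 where j0: "j0 < J" "R j0 \<noteq> 0 \<or> S j0 \<noteq> 0"
  proof (rule ccontr)
    assume "\<not> thesis"
    then have "r j = r' j \<and> s j = s' j" if "j < J" for j
      using that \<open>\<And>j0. j0 < J \<Longrightarrow> R j0 \<noteq> 0 \<or> S j0 \<noteq> 0 \<Longrightarrow> thesis\<close> by (auto simp: R_def S_def)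
    then have "r = r'" "s = s'"
      using rs(1,2)
      by (intro PiE_ext[of _ "{..<J}" "\<lambda>_. polys_below A"]; simp add: V_def)+
    then show False using rs by simp
  qed
  have L0: "L (R, S) k = 0" if "k < M" for k
  proof -
    have "L (R, S) k = L (r, s) k - L (r', s') k"
      by (simp add: L_def R_def S_def hasse_diff P_diff sum_subtractf[symmetric] algebra_simps smult_diff_right)
    also have "\<dots> = 0" using fun_cong[OF eq, of k] that by simp
    finally show ?thesis .
  qed
  define w where "w = (\<lambda>j. R j + f ^ n * S j)"
  define \<phi> where "\<phi> = (\<Sum>j<J. w j * ?X ^ j)"
  have "\<phi> \<noteq> 0"
  proof
    assume "\<phi> = 0"
    \<comment> \<open>The degrees are at most \<open>A - 1\<close>, so
      \<open>2 * A + card U <= CARD('a) + 1\<close> gives the strict degree bounds required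
      here.\<close>
    then have "R j0 = 0 \<and> S j0 = 0"
      using deg A j0(1)
      by (intro auxiliary_poly_nonzero[OF odd U n, of J R S]) (fastforce simp: \<phi>_def w_def f_def)+
    then show False using j0 by simp
  qed
  moreover have "[:- x, 1:] ^ M dvd \<phi>" if x: "poly f x ^ n = \<sigma>" for x
  proof -
    \<comment> \<open>Replacing \<open>X^q\<close> by the constant \<open>x\<close> changes the
      polynomial by a multiple of \<open>X^q - x = (X - x)^q\<close>, which is harmless since
      \<open>M <= q\<close>. Vanishing can therefore be tested on \<open>\<psi>\<close>.\<close>
    define \<psi> where "\<psi> = (\<Sum>j<J. smult (x ^ j) (w j))"
    have n0: "n > 0" using odd q2 n by (auto elim!: oddE)
    have fx: "poly f x \<noteq> 0" using x \<sigma> n0 by (auto simp: power_0_left)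
    have "[:- x, 1:] ^ M dvd \<psi>"
    proof (rule power_dvd_if_hasse_zero)
      fix k assume k: "k < M"
      have "\<sigma> = poly f x ^ k * poly f x ^ (n - k)"
        using x k M by (simp flip: power_add)
      then have "poly f x ^ k * poly (hasse k \<psi>) x = poly (L (R, S) k) x"
        unfolding \<psi>_def L_def w_def hasse_sum hasse_smult hasse_add P
        by (simp add: poly_sum poly_monom sum_distrib_left algebra_simps)
      then show "poly (hasse k \<psi>) x = 0" using L0[OF k] fx by simp
    qed
    moreover have "[:- x, 1:] ^ M dvd \<phi> - \<psi>"
    proof -
      have "[:- x, 1:] ^ M dvd [:- x, 1:] ^ ?q"
        using M n by (intro le_imp_power_dvd) linarith
      also have "\<dots> = ?X - [:x:]" by (rule linear_power_card)
      finally have "[:- x, 1:] ^ M dvd ?X ^ j - [:x:] ^ j" for j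
        using diff_dvd_power_diff dvd_trans by blast
      then have "[:- x, 1:] ^ M dvd (\<Sum>j<J. w j * (?X ^ j - [:x:] ^ j))"
        by (intro dvd_sum dvd_mult)
      also have "\<dots> = \<phi> - \<psi>"
        by (simp add: \<phi>_def \<psi>_def right_diff_distrib sum_subtractf poly_const_pow)
      finally show ?thesis .
    qed
    ultimately show ?thesis
      using dvd_add[of _ "\<phi> - \<psi>" \<psi>] by simp
  qed
  ultimately have "M * card {x. poly f x ^ n = \<sigma>} \<le> degree \<phi>"
    by (intro card_mult_le_degree) auto
  also have "degree \<phi> \<le> A + n * d + J * ?q"
    unfolding \<phi>_def
  proof (rule degree_sum_le)
    fix j assume "j \<in> {..<J}"
    then have j: "j < J" by simp
    have "degree (w j) \<le> A + n * d"
      unfolding w_def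
      using deg[OF j] degree_mult_le[of "f ^ n" "S j"] f0
      by (intro degree_add_le) (simp_all add: degree_power_eq deg_f)
    moreover have "degree (?X ^ j) \<le> J * ?q"
      using j by (simp add: monom_power degree_monom_eq)
    ultimately show "degree (w j * ?X ^ j) \<le> A + n * d + J * ?q"
      using degree_mult_le[of "w j" "?X ^ j"] by linarith
  qed simp
  finally show ?thesis by (simp add: f_def d_def)
qed

section \<open>Quadratic character sums\<close>

definition qchar :: "'a::field \<Rightarrow> int" where
  "qchar x = (if x = 0 then 0 else if \<exists>y. x = y ^ 2 then 1 else - 1)"

text \<open>Translation by 1 permutes the field, so summing all elements gives \<open>q = 0\<close>
  in the field. With \<open>q\<close> odd and \<open>2 = 0\<close> this would read
  \<open>1 = 0\<close>.\<close>

lemma one_neq_minus_one: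
  assumes "odd CARD('a)"
  shows "(1 :: 'a::finite_field) \<noteq> - 1"
proof
  assume "(1 :: 'a) = - 1"
  then have two: "(2 :: 'a) = 0"
    by (metis add.right_inverse one_add_one)
  have "(\<Sum>x\<in>UNIV. x + 1) = (\<Sum>x\<in>UNIV. x :: 'a)"
    by (rule sum.reindex_bij_witness[of _ "\<lambda>x. x - 1" "\<lambda>x. x + 1"]) auto
  then have "(of_nat CARD('a) :: 'a) = 0" by (simp add: sum.distrib)
  moreover obtain k where "CARD('a) = 2 * k + 1" using assms by (elim oddE)
  ultimately show False using two by simp
qed

lemma card_sqrt_le: "card {y. y ^ 2 = x} \<le> 2" for x :: "'a::field"
proof (cases "\<exists>y. y ^ 2 = x")
  case True
  then obtain y where "y ^ 2 = x" ..
  then have "{y. y ^ 2 = x} \<subseteq> {y, - y}" by (auto simp: power2_eq_iff)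
  then show ?thesis
    using card_mono[of "{y, - y}" "{y. y ^ 2 = x}"] card_insert_le_m1[of 2 "{- y}" y] by simp
qed simp

text \<open>Euler's criterion by counting: nonzero squares have at most two roots each, so there are
  at least \<open>n\<close> of them. All satisfy \<open>x ^ n = 1\<close>, an equation with at most
  \<open>n\<close> solutions.\<close>

lemma of_int_qchar:
  fixes x :: "'a::finite_field"
  assumes odd: "odd CARD('a)" and n: "n = (CARD('a) - 1) div 2"
  shows "of_int (qchar x) = x ^ n"
proof -
  have q: "CARD('a) = 2 * n + 1" using odd n by (auto elim!: oddE)
  have "CARD('a) \<ge> 2" using card_mono[of UNIV "{0, 1 :: 'a}"] by simp
  then have n0: "n > 0" using q by simp
  have pow: "y ^ (2 * n) = 1" if "y \<noteq> 0" for y :: 'a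
    using finite_field_power_card_eq_same[of y] that unfolding q by simp
  let ?S = "{x :: 'a. x \<noteq> 0 \<and> (\<exists>y. x = y ^ 2)}" and ?R = "{x :: 'a. x ^ n = 1}"
  have sub: "?S \<subseteq> ?R" using pow by (auto simp: power_mult)
  have "2 * n = card (UNIV - {0 :: 'a})" using q by simp
  also have "UNIV - {0 :: 'a} = (\<Union>x\<in>?S. {y. y ^ 2 = x})" by auto
  also have "card \<dots> \<le> (\<Sum>x\<in>?S. card {y. y ^ 2 = x})" by (rule card_UN_le) simp
  also have "\<dots> \<le> (\<Sum>x\<in>?S. 2)" by (intro sum_mono card_sqrt_le)
  finally have "n \<le> card ?S" by simp
  moreover have "card ?R \<le> n"
  proof -
    let ?p = "monom 1 n - 1 :: 'a poly"
    have "coeff ?p n = 1" using n0 by simp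
    then have "?p \<noteq> 0" by (metis coeff_0 zero_neq_one)
    moreover have "?R = {x. poly ?p x = 0}" by (simp add: poly_monom)
    moreover have "degree ?p \<le> n" by (intro degree_diff_le) (auto simp: degree_monom_le)
    ultimately show ?thesis using card_poly_roots_bound[of ?p] by simp
  qed
  ultimately have "?S = ?R" using sub by (intro card_seteq) auto
  moreover have "x ^ n = 1 \<or> x ^ n = - 1" if "x \<noteq> 0"
    using pow[OF that] by (simp add: mult.commute[of 2] power_mult power2_eq_1_iff)
  ultimately show ?thesis
    using n0 by (auto simp: qchar_def)
qed

lemma qchar_cases: "qchar x \<in> {- 1, 0, 1}"
  by (simp add: qchar_def)

text \<open>Lets identities between character values be proved inside the field and read back in the
  integers.\<close>

lemma of_int_inj_signs:
  assumes "odd CARD('a)" "a \<in> {- 1, 0, 1}" "b \<in> {- 1, 0, 1}"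
    and "(of_int a :: 'a::finite_field) = of_int b"
  shows "a = b"
  using assms one_neq_minus_one[where ?'a = 'a] by auto

lemma qchar_minus:
  fixes x :: "'a::finite_field"
  assumes "CARD('a) mod 4 = 1"
  shows "qchar (- x) = qchar x"
proof -
  have odd: "odd CARD('a)" and "even ((CARD('a) - 1) div 2)"
    using assms by presburger+
  then have "of_int (qchar (- x)) = (of_int (qchar x) :: 'a)"
    unfolding of_int_qchar[OF odd refl] by simp
  then show ?thesis using of_int_inj_signs[OF odd qchar_cases qchar_cases] by blast
qed

lemma stepanov_bound_explicit:
  fixes U :: "'a::finite_field set" and \<sigma> :: 'a
  assumes odd: "odd CARD('a)" and U: "U \<noteq> {}"
    and n: "n = (CARD('a) - 1) div 2" and \<sigma>: "\<sigma> \<noteq> 0"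
    and N: "N > 0" and large: "12 * N ^ 2 * card U ^ 2 < CARD('a)"
  shows "2 * N * card {x. poly (root_poly U) x ^ n = \<sigma>} \<le> (N + 2) * CARD('a)"
proof -
  \<comment> \<open>The parameters will be \<open>M = 2 * m\<close> and \<open>J = m + d\<close>,
    with \<open>A\<close> the largest value allowed by the degree condition. Since
    \<open>m = N * d\<close>, the leading term \<open>J * q / M\<close> is
    \<open>q / 2 + q / (2 * N)\<close>.\<close>
  define q d m where "q = CARD('a)" and "d = card U" and "m = N * d"
  define A where "A = (q + 1 - d) div 2"
  have d: "d > 0" using U by (simp add: d_def card_gt_0_iff)
  have dm: "d \<le> m" using N by (simp add: m_def)
  have q12: "12 * m ^ 2 < q" using large by (simp add: m_def q_def d_def power_mult_distrib mult.assoc)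
  have mm: "m \<le> m ^ 2" using d dm by (simp add: power2_eq_square)
  have A: "q \<le> 2 * A + d" "2 * A + d \<le> q + 1" "A > 0" "2 * A \<le> q"
    using q12 mm dm d unfolding A_def by linarith+
  have "2 * m \<le> n" using q12 mm dm d n by (simp add: q_def)
  \<comment> \<open>After cancelling \<open>2 * m * A\<close> there remains
    \<open>2 * m * (m + d) + 4 * m^2 * d < 2 * A * d\<close>. The right side is at least
    \<open>q * d - d^2\<close>, and \<open>q > 12 * m^2\<close> leaves enough room.\<close>
  moreover have "2 * m * (m + d + A + 2 * m * d) < 2 * A * (m + d)"
  proof -
    have "m \<le> m * d" "d * d \<le> m * d" "m * m \<le> m * m * d" "m * d \<le> m * m * d"
      using d dm mm by (auto simp: power2_eq_square)
    moreover have "12 * (m * m) * d < q * d" using q12 d by (simp add: power2_eq_square)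
    moreover have "q * d \<le> (2 * A + d) * d" using A d by (intro mult_right_mono) auto
    ultimately show ?thesis by (simp only: algebra_simps)
  qed
  ultimately have "2 * m * card {x. poly (root_poly U) x ^ n = \<sigma>} \<le> A + n * d + (m + d) * q"
    using stepanov_bound[OF odd U n \<sigma>, of A "2 * m" "m + d"] A by (simp add: q_def d_def)
  also have "\<dots> \<le> d * ((N + 2) * q)"
  proof -
    have "2 * n \<le> q" using n by (simp add: q_def)
    then have "2 * n * d \<le> q * d" by (rule mult_right_mono) simp
    moreover have "q \<le> q * d" using d by simp
    ultimately have "2 * (A + n * d + (m + d) * q) \<le> 2 * (d * ((N + 2) * q))"
      using A by (simp only: m_def algebra_simps)
    then show ?thesis by simp
  qed
  finally have "d * (2 * N * card {x. poly (root_poly U) x ^ n = \<sigma>}) \<le> d * ((N + 2) * q)"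
    by (simp only: m_def mult_ac)
  then show ?thesis using d by (simp add: q_def)
qed

text \<open>Stepanov's method bounds the number of points with value 1 and with value -1 from above.
  Together with the zeros \<open>U\<close> these exhaust the field, so neither number can be much
  below half.\<close>

theorem qchar_sum_bound:
  fixes U :: "'a::finite_field set"
  assumes odd: "odd CARD('a)" and U: "U \<noteq> {}"
    and N: "N > 0" and large: "12 * N ^ 2 * card U ^ 2 < CARD('a)"
  shows "int N * \<bar>\<Sum>v\<in>UNIV. \<Prod>u\<in>U. qchar (v - u)\<bar> \<le> 3 * int CARD('a)"
proof -
  define n where "n = (CARD('a) - 1) div 2"
  define g :: "'a \<Rightarrow> int" where "g = (\<lambda>v. \<Prod>u\<in>U. qchar (v - u))"
  have g: "of_int (g v) = poly (root_poly U) v ^ n" for v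
    by (simp add: g_def poly_root_poly of_int_qchar[OF odd n_def] prod_power_distrib)
  have g_cases: "g v \<in> {- 1, 0, 1}" for v
  proof -
    have "\<bar>g v\<bar> = (\<Prod>u\<in>U. \<bar>qchar (v - u)\<bar>)" by (simp add: g_def abs_prod)
    also have "\<dots> \<le> 1" by (intro prod_le_1) (auto simp: qchar_def)
    finally show ?thesis by auto
  qed
  define A B where "A = {v. g v = 1}" and "B = {v. g v = - 1}"
  have "A = {x. poly (root_poly U) x ^ n = 1}" "B = {x. poly (root_poly U) x ^ n = - 1}"
    unfolding A_def B_def g[symmetric]
    using of_int_inj_signs[OF odd g_cases, of 1] of_int_inj_signs[OF odd g_cases, of "- 1"] by auto
  then have "2 * N * card A \<le> (N + 2) * CARD('a)" "2 * N * card B \<le> (N + 2) * CARD('a)"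
    using stepanov_bound_explicit[OF odd U n_def _ N large] by auto
  then have "int (2 * N * card A) \<le> int ((N + 2) * CARD('a))" "int (2 * N * card B) \<le> int ((N + 2) * CARD('a))"
    by (simp_all only: of_nat_le_iff)
  then have AB: "2 * int N * int (card A) \<le> (int N + 2) * int CARD('a)"
    "2 * int N * int (card B) \<le> (int N + 2) * int CARD('a)"
    by (simp_all only: of_nat_mult of_nat_add of_nat_numeral)
  have "UNIV = A \<union> B \<union> U"
  proof -
    have "v \<in> U" if "g v = 0" for v using that by (auto simp: g_def qchar_def split: if_splits)
    then show ?thesis using g_cases by (auto simp: A_def B_def)
  qed
  then have "CARD('a) \<le> card A + card B + card U"
    by (metis card_Un_le add_le_mono1 le_trans)
  then have q: "int CARD('a) \<le> int (card A) + int (card B) + int (card U)" by linarith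
  have disj: "int (card A) + int (card B) \<le> int CARD('a)"
  proof -
    have "card (A \<union> B) = card A + card B" by (intro card_Un_disjoint) (auto simp: A_def B_def)
    then show ?thesis using card_mono[of UNIV "A \<union> B"] by simp
  qed
  have "(\<Sum>v\<in>UNIV. g v) = (\<Sum>v\<in>UNIV. of_bool (v \<in> A) - of_bool (v \<in> B))"
    using g_cases by (intro sum.cong) (auto simp: A_def B_def)
  also have "\<dots> = int (card A) - int (card B)"
    by (simp add: sum_subtractf sum_of_bool_eq)
  finally have sum: "(\<Sum>v\<in>UNIV. g v) = int (card A) - int (card B)" .
  have NU: "int N * int (card U) \<le> int CARD('a)"
  proof -
    have "N * card U \<le> (N * card U) ^ 2"
      by (cases "N * card U") (simp_all add: power2_eq_square)
    then have "N * card U \<le> CARD('a)" using large by (simp add: power_mult_distrib)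
    then show ?thesis by (simp flip: of_nat_mult)
  qed
  \<comment> \<open>In the constant 3, two units come from the excess in the Stepanov bound and one
    from the zeros, via \<open>NU\<close>.\<close>
  have "int N * int CARD('a) \<le> int N * (int (card A) + int (card B) + int (card U))"
    "int N * (int (card A) + int (card B)) \<le> int N * int CARD('a)"
    using q disj by (intro mult_left_mono; simp)+
  then have "int N * (int (card A) - int (card B)) \<le> 3 * int CARD('a)"
    "int N * (int (card B) - int (card A)) \<le> 3 * int CARD('a)"
    using AB NU by (simp_all add: algebra_simps)
  then have "\<bar>int N * (int (card A) - int (card B))\<bar> \<le> 3 * int CARD('a)"
    by (simp add: abs_le_iff algebra_simps)
  then show ?thesis
    using sum by (simp add: abs_mult g_def)
qed

section \<open>Elementary symmetric functions of signs\<close>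

text \<open>Majorants of generating functions: they allow signs in the factors to be discarded
  before estimating a coefficient.\<close>

definition dominated :: "real poly \<Rightarrow> real poly \<Rightarrow> bool" where
  "dominated p P \<longleftrightarrow> (\<forall>i. \<bar>coeff p i\<bar> \<le> coeff P i)"

lemma dominated_mult: "dominated p P \<Longrightarrow> dominated q Q \<Longrightarrow> dominated (p * q) (P * Q)"
  unfolding dominated_def coeff_mult
proof (intro allI)
  fix i assume *: "\<forall>i. \<bar>coeff p i\<bar> \<le> coeff P i" "\<forall>i. \<bar>coeff q i\<bar> \<le> coeff Q i"
  have "\<bar>\<Sum>j\<le>i. coeff p j * coeff q (i - j)\<bar> \<le> (\<Sum>j\<le>i. \<bar>coeff p j * coeff q (i - j)\<bar>)"
    by (rule sum_abs)
  also have "\<dots> \<le> (\<Sum>j\<le>i. coeff P j * coeff Q (i - j))"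
    using * by (intro sum_mono) (simp add: abs_mult mult_mono')
  finally show "\<bar>\<Sum>j\<le>i. coeff p j * coeff q (i - j)\<bar> \<le> (\<Sum>j\<le>i. coeff P j * coeff Q (i - j))" .
qed

lemma dominated_power: "dominated p P \<Longrightarrow> dominated (p ^ n) (P ^ n)"
  by (induction n) (simp_all add: dominated_mult, simp add: dominated_def)

text \<open>A Cauchy-type estimate: a majorant has nonnegative coefficients, so at positive
  \<open>\<rho>\<close> a single term is at most the whole value.\<close>

lemma dominated_coeff_le:
  assumes "dominated p P" "\<rho> > 0"
  shows "\<bar>coeff p t\<bar> * \<rho> ^ t \<le> poly P \<rho>"
proof -
  have nonneg: "coeff P i \<ge> 0" for i
    using assms(1) abs_ge_zero order_trans unfolding dominated_def by blast
  have "\<bar>coeff p t\<bar> * \<rho> ^ t \<le> coeff P t * \<rho> ^ t"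
    using assms by (simp add: dominated_def mult_right_mono)
  also have "\<dots> \<le> poly P \<rho>"
  proof (cases "t \<le> degree P")
    case True
    then show ?thesis
      unfolding poly_altdef using nonneg assms(2)
      by (intro member_le_sum[of t "{..degree P}" "\<lambda>i. coeff P i * \<rho> ^ i"]) auto
  next
    case False
    then show ?thesis
      unfolding poly_altdef using nonneg assms(2) by (simp add: coeff_eq_0 sum_nonneg)
  qed
  finally show ?thesis .
qed

text \<open>Generating function of the elementary symmetric functions: expanding the product selects
  the set \<open>T\<close> of factors that contribute their linear term.\<close>

lemma coeff_prod_linear:
  fixes g :: "'b \<Rightarrow> 'a::comm_ring_1"
  assumes "finite V"
  shows "coeff (\<Prod>v\<in>V. [:1, g v:]) t = (\<Sum>T | T \<subseteq> V \<and> card T = t. \<Prod>v\<in>T. g v)"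
proof -
  have m: "(\<Prod>v\<in>T. [:0, g v:]) = monom (\<Prod>v\<in>T. g v) (card T)" if "finite T" for T
    using that by induction (simp_all add: monom_Suc smult_monom)
  have "(\<Prod>v\<in>V. [:1, g v:]) = (\<Prod>v\<in>V. [:0, g v:] + 1)" by (simp add: one_pCons)
  also have "\<dots> = (\<Sum>T\<in>Pow V. \<Prod>v\<in>T. [:0, g v:])"
    using assms by (subst prod_add) simp_all
  also have "\<dots> = (\<Sum>T\<in>Pow V. monom (\<Prod>v\<in>T. g v) (card T))"
    using assms by (intro sum.cong refl m) (auto intro: finite_subset)
  also have "coeff \<dots> t = (\<Sum>T\<in>Pow V. if card T = t then \<Prod>v\<in>T. g v else 0)"
    by (simp add: coeff_sum)
  also have "\<dots> = (\<Sum>T | T \<subseteq> V \<and> card T = t. \<Prod>v\<in>T. g v)"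
    using assms by (subst sum.inter_filter[symmetric]) simp_all
  finally show ?thesis .
qed

text \<open>Factors \<open>1 + z\<close> and \<open>1 - z\<close> of the generating function are paired into
  \<open>1 - z\<^sup>2\<close>; only the excess of one sign contributes to first order.\<close>

lemma elementary_symmetric_sign_bound:
  fixes g :: "'b \<Rightarrow> real"
  assumes V: "finite V" and g: "\<And>v. v \<in> V \<Longrightarrow> g v \<in> {- 1, 0, 1}" and \<rho>: "\<rho> > 0"
  shows "\<bar>\<Sum>T | T \<subseteq> V \<and> card T = t. \<Prod>v\<in>T. g v\<bar> * \<rho> ^ t
    \<le> exp (real (card V) / 2 * \<rho> ^ 2 + \<bar>\<Sum>v\<in>V. g v\<bar> * \<rho>)"
proof -
  define A B where "A = {v \<in> V. g v = 1}" and "B = {v \<in> V. g v = - 1}"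
  define m where "m = min (card A) (card B)"
  define c where "c = card A - m"
  define e where "e = card B - m"
  have AB: "finite A" "finite B" "A \<inter> B = {}" "A \<union> B \<subseteq> V" using V by (auto simp: A_def B_def)
  have sum: "(\<Sum>v\<in>V. g v) = real (card A) - real (card B)"
  proof -
    have "(\<Sum>v\<in>V. g v) = (\<Sum>v\<in>A \<union> B. g v)"
      using V g by (intro sum.mono_neutral_right) (auto simp: A_def B_def)
    also have "\<dots> = (\<Sum>v\<in>A. g v) + (\<Sum>v\<in>B. g v)" using AB by (simp add: sum.union_disjoint)
    finally show ?thesis by (simp add: A_def B_def)
  qed
  \<comment> \<open>At least one of \<open>c\<close> and \<open>e\<close> is zero, so their sum is
    the absolute difference.\<close>
  have ce: "real (c + e) = \<bar>\<Sum>v\<in>V. g v\<bar>" unfolding sum c_def e_def m_def by auto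
  have "card A + card B \<le> card V"
    using AB V by (metis card_Un_disjoint card_mono)
  then have m: "real m \<le> real (card V) / 2" by (simp add: m_def)
  define p :: "real poly" where "p = (\<Prod>v\<in>V. [:1, g v:])"
  have "p = (\<Prod>v\<in>A \<union> B. [:1, g v:])"
    unfolding p_def using V g by (intro prod.mono_neutral_right) (auto simp: A_def B_def one_pCons)
  also have "\<dots> = (\<Prod>v\<in>A. [:1, g v:]) * (\<Prod>v\<in>B. [:1, g v:])" using AB by (simp add: prod.union_disjoint)
  also have "\<dots> = [:1, 1:] ^ card A * [:1, - 1:] ^ card B" by (simp add: A_def B_def)
  also have "\<dots> = ([:1, 1:] ^ m * [:1, 1:] ^ c) * ([:1, - 1:] ^ m * [:1, - 1:] ^ e)"
    by (simp add: c_def e_def m_def flip: power_add)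
  also have "\<dots> = ([:1, 1:] * [:1, - 1:]) ^ m * ([:1, 1:] ^ c * [:1, - 1:] ^ e)"
    by (simp only: power_mult_distrib mult_ac)
  finally have p: "p = ([:1, 1:] * [:1, - 1:]) ^ m * ([:1, 1:] ^ c * [:1, - 1:] ^ e)" .
  define P :: "real poly" where "P = [:1, 0, 1:] ^ m * ([:1, 1:] ^ c * [:1, 1:] ^ e)"
  have "dominated p P"
    unfolding p P_def
    by (intro dominated_mult[of "_ ^ _" "_ ^ _"]
        dominated_mult[of "_ ^ _ * _ ^ _" "_ ^ _ * _ ^ _"] dominated_power)
      (auto simp: dominated_def coeff_pCons split: nat.splits)
  then have "\<bar>coeff p t\<bar> * \<rho> ^ t \<le> poly P \<rho>" using \<rho> by (rule dominated_coeff_le)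
  also have "\<dots> = (1 + \<rho> ^ 2) ^ m * (1 + \<rho>) ^ (c + e)"
    by (simp add: P_def power2_eq_square power_add)
  also have "\<dots> \<le> exp (\<rho> ^ 2) ^ m * exp \<rho> ^ (c + e)"
    using \<rho> by (intro mult_mono power_mono exp_ge_add_one_self) auto
  also have "\<dots> = exp (real m * \<rho> ^ 2 + real (c + e) * \<rho>)"
    by (simp only: exp_of_nat_mult exp_add)
  also have "\<dots> \<le> exp (real (card V) / 2 * \<rho> ^ 2 + \<bar>\<Sum>v\<in>V. g v\<bar> * \<rho>)"
    using mult_right_mono[OF m, of "\<rho> ^ 2"] unfolding ce by simp
  finally show ?thesis using coeff_prod_linear[OF V, of g t] by (simp add: p_def)
qed

section \<open>Balanced subsets of a symmetric sign matrix\<close>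

text \<open>The Seidel matrix of a graph up to sign: 1 for edges, -1 for non-edges, 0 on the
  diagonal.\<close>

locale sign_matrix =
  fixes V :: "'b set" and a :: "'b \<Rightarrow> 'b \<Rightarrow> real"
  assumes finite_V: "finite V"
    and sym: "x \<in> V \<Longrightarrow> y \<in> V \<Longrightarrow> a x y = a y x"
    and diag: "x \<in> V \<Longrightarrow> a x x = 0"
    and off_diag: "x \<in> V \<Longrightarrow> y \<in> V \<Longrightarrow> x \<noteq> y \<Longrightarrow> a x y \<in> {- 1, 1}"
begin

text \<open>The parity of the degree of \<open>v\<close> is the sign of the product of
  \<open>- a v u\<close> over the \<open>card S - 1\<close> other vertices, so this is evenness of
  the induced subgraph.\<close>

definition balanced :: "'b set \<Rightarrow> bool" where
  "balanced S \<longleftrightarrow> (\<forall>v\<in>S. (\<Prod>u\<in>S - {v}. a v u) = (- 1) ^ (card S - 1))"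

definition cross :: "'b set \<Rightarrow> 'b set \<Rightarrow> real" where
  "cross T U = (\<Prod>v\<in>T. \<Prod>u\<in>U. a v u)"

definition layer :: "nat \<Rightarrow> 'b set set" where
  "layer k = {U. U \<subseteq> V \<and> card U = k}"

text \<open>Both sets run over full layers; an overlapping pair contributes zero through the
  diagonal. This makes the inner sum an elementary symmetric function over all of
  \<open>V\<close>.\<close>

definition cross_sum :: "nat \<Rightarrow> nat \<Rightarrow> real" where
  "cross_sum t k = (\<Sum>U\<in>layer k. \<Sum>T\<in>layer t. cross T U)"

lemma finite_layer: "finite (layer k)"
  using finite_V by (auto simp: layer_def intro: finite_subset[of _ "Pow V"])

lemma card_layer: "card (layer k) = card V choose k"
  unfolding layer_def using finite_V by (rule n_subsets)

lemma finite_sub: "S \<subseteq> V \<Longrightarrow> finite S"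
  using finite_V by (rule finite_subset[rotated])

lemma prod_sign:
  assumes "\<And>x. x \<in> S \<Longrightarrow> f x \<in> {- 1, 1 :: real}"
  shows "(\<Prod>x\<in>S. f x) \<in> {- 1, 1}"
proof -
  have "\<bar>\<Prod>x\<in>S. f x\<bar> = (\<Prod>x\<in>S. \<bar>f x\<bar>)" by (rule abs_prod)
  also have "\<dots> = 1" using assms by (intro prod.neutral) fastforce
  finally show ?thesis by auto
qed

text \<open>Each unordered pair contributes the square of a sign.\<close>

lemma inner_prod_eq_1:
  assumes "T \<subseteq> V"
  shows "(\<Prod>v\<in>T. \<Prod>u\<in>T - {v}. a v u) = 1"
  using finite_sub[OF assms] assms
proof (induction T rule: finite_induct)
  case (insert x T)
  have "(\<Prod>v\<in>insert x T. \<Prod>u\<in>insert x T - {v}. a v u)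
      = (\<Prod>u\<in>T. a x u) * (\<Prod>v\<in>T. \<Prod>u\<in>insert x T - {v}. a v u)"
    using insert by simp
  also have "(\<Prod>v\<in>T. \<Prod>u\<in>insert x T - {v}. a v u) = (\<Prod>v\<in>T. a v x * (\<Prod>u\<in>T - {v}. a v u))"
  proof (rule prod.cong)
    fix v assume "v \<in> T"
    then have "insert x T - {v} = insert x (T - {v})" using insert by auto
    then show "(\<Prod>u\<in>insert x T - {v}. a v u) = a v x * (\<Prod>u\<in>T - {v}. a v u)"
      using insert by simp
  qed simp
  also have "\<dots> = (\<Prod>v\<in>T. a v x)" using insert by (simp add: prod.distrib)
  also have "(\<Prod>u\<in>T. a x u) * (\<Prod>v\<in>T. a v x) = (\<Prod>v\<in>T. a x v * a v x)"
    by (simp add: prod.distrib)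
  also have "\<dots> = 1"
    using insert sym off_diag by (intro prod.neutral) fastforce
  finally show ?case .
qed simp

text \<open>For each vertex \<open>h v + 1\<close> is 2 if its condition holds and 0 otherwise.
  Expanding the product over subsets \<open>T\<close>, the entries inside \<open>T\<close> cancel by
  \<open>inner_prod_eq_1\<close>.\<close>

lemma balanced_expansion:
  assumes S: "S \<subseteq> V" and r: "card S = r"
  shows "of_bool (balanced S) * 2 ^ r
    = (\<Sum>T\<in>Pow S. ((- 1) ^ (r - 1)) ^ card T * cross T (S - T))"
proof -
  define \<epsilon> :: real where "\<epsilon> = (- 1) ^ (r - 1)"
  define h where "h = (\<lambda>v. \<epsilon> * (\<Prod>u\<in>S - {v}. a v u))"
  have fin: "finite S" using S by (rule finite_sub)
  have \<epsilon>: "\<epsilon> \<in> {- 1, 1}" by (simp add: \<epsilon>_def minus_one_power_iff)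
  have sgn: "(\<Prod>u\<in>S - {v}. a v u) \<in> {- 1, 1}" if "v \<in> S" for v
    using fin S that off_diag by (intro prod_sign) auto
  have "of_bool (balanced S) * 2 ^ r = (\<Prod>v\<in>S. h v + 1)"
  proof (cases "balanced S")
    case True
    then have "h v = 1" if "v \<in> S" for v
      using that \<epsilon> by (auto simp: balanced_def h_def r \<epsilon>_def)
    then show ?thesis using True r by simp
  next
    case False
    then obtain v where v: "v \<in> S" "(\<Prod>u\<in>S - {v}. a v u) \<noteq> \<epsilon>"
      by (auto simp: balanced_def \<epsilon>_def r)
    then have "h v + 1 = 0" using \<epsilon> sgn[of v] by (auto simp: h_def)
    then have "(\<Prod>v\<in>S. h v + 1) = 0" using v fin by (intro prod_zero) auto
    then show ?thesis using False by simp
  qed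
  also have "\<dots> = (\<Sum>T\<in>Pow S. \<Prod>v\<in>T. h v)" using fin by (subst prod_add) simp_all
  also have "\<dots> = (\<Sum>T\<in>Pow S. \<epsilon> ^ card T * cross T (S - T))"
  proof (rule sum.cong)
    fix T assume "T \<in> Pow S"
    then have T: "T \<subseteq> S" by simp
    have "(\<Prod>u\<in>S - {v}. a v u) = (\<Prod>u\<in>T - {v}. a v u) * (\<Prod>u\<in>S - T. a v u)" if "v \<in> T" for v
    proof -
      have *: "S - {v} = (T - {v}) \<union> (S - T)" using T that by auto
      show ?thesis
        unfolding * using fin T by (intro prod.union_disjoint) (auto intro: finite_subset)
    qed
    then have "(\<Prod>v\<in>T. h v) = \<epsilon> ^ card T * ((\<Prod>v\<in>T. \<Prod>u\<in>T - {v}. a v u) * cross T (S - T))"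
      by (simp add: h_def prod.distrib cross_def)
    then show "(\<Prod>v\<in>T. h v) = \<epsilon> ^ card T * cross T (S - T)"
      using inner_prod_eq_1[of T] S T by simp
  qed simp
  finally show ?thesis by (simp add: \<epsilon>_def)
qed

section \<open>Counting balanced sets by cross sums\<close>

lemma cross_nonzero_imp_disjoint:
  assumes "T \<subseteq> V" "U \<subseteq> V" "cross T U \<noteq> 0" "x \<in> T"
  shows "x \<notin> U"
proof
  assume "x \<in> U"
  then have "(\<Prod>u\<in>U. a x u) = 0"
    using assms finite_sub[of U] diag[of x] by (intro prod_zero bexI[of _ x]) auto
  then have "cross T U = 0"
    unfolding cross_def by (rule prod_zero[OF finite_sub[OF assms(1)] bexI[OF _ assms(4)]])
  then show False using assms by simp
qed

lemma cross_commute: "T \<subseteq> V \<Longrightarrow> U \<subseteq> V \<Longrightarrow> cross T U = cross U T"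
  unfolding cross_def by (subst prod.swap) (auto intro!: prod.cong sym)

lemma cross_sum_commute: "cross_sum t k = cross_sum k t"
  unfolding cross_sum_def
  by (subst sum.swap) (auto intro!: sum.cong cross_commute simp: layer_def)

lemma count_balanced:
  assumes "r > 0"
  shows "real (card {S. S \<subseteq> V \<and> card S = r \<and> balanced S}) * 2 ^ r
    = (\<Sum>k\<le>r. ((- 1) ^ (r - 1)) ^ (r - k) * cross_sum (r - k) k)"
proof -
  define \<epsilon> :: real where "\<epsilon> = (- 1) ^ (r - 1)"
  have "real (card {S. S \<subseteq> V \<and> card S = r \<and> balanced S}) = (\<Sum>S\<in>layer r. of_bool (balanced S))"
  proof -
    have "{S. S \<subseteq> V \<and> card S = r \<and> balanced S} = layer r \<inter> {S. balanced S}" by (auto simp: layer_def)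
    then show ?thesis using finite_layer by (simp add: sum_of_bool_eq)
  qed
  then have "real (card {S. S \<subseteq> V \<and> card S = r \<and> balanced S}) * 2 ^ r
      = (\<Sum>S\<in>layer r. of_bool (balanced S) * 2 ^ r)" by (simp add: sum_distrib_right)
  also have "\<dots> = (\<Sum>S\<in>layer r. \<Sum>T\<in>Pow S. \<epsilon> ^ card T * cross T (S - T))"
    by (intro sum.cong) (auto simp: layer_def balanced_expansion \<epsilon>_def)
  also have "\<dots> = (\<Sum>(S, T)\<in>(SIGMA S:layer r. Pow S). \<epsilon> ^ card T * cross T (S - T))"
    using finite_layer by (intro sum.Sigma) (auto simp: layer_def finite_sub)
  \<comment> \<open>The pair \<open>(S, T)\<close> is encoded by the two disjoint parts
    \<open>U = S - T\<close> and \<open>T\<close>, graded by the size of \<open>U\<close>.\<close>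
  also have "\<dots> = (\<Sum>(k, U, T)\<in>{(k, U, T). k \<le> r \<and> U \<in> layer k \<and> T \<in> layer (r - k) \<and> T \<inter> U = {}}.
      \<epsilon> ^ (r - k) * cross T U)"
  proof (rule sum.reindex_bij_witness[where i = "\<lambda>(k, U, T). (T \<union> U, T)" and j = "\<lambda>(S, T). (card (S - T), S - T, T)"])
    fix p assume "p \<in> (SIGMA S:layer r. Pow S)"
    then obtain S T where p: "p = (S, T)" "S \<in> layer r" "T \<subseteq> S" by auto
    then have fin: "finite S" "finite T" by (auto simp: layer_def finite_sub finite_subset)
    have c: "card (S - T) = r - card T" "card T \<le> r"
      using p fin by (auto simp: layer_def card_Diff_subset card_mono)
    then have c': "r - card (S - T) = card T" by simp
    show "(case case p of (S, T) \<Rightarrow> (card (S - T), S - T, T) of (k, U, T) \<Rightarrow> (T \<union> U, T)) = p"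
      using p by auto
    show "(case p of (S, T) \<Rightarrow> (card (S - T), S - T, T)) \<in>
        {(k, U, T). k \<le> r \<and> U \<in> layer k \<and> T \<in> layer (r - k) \<and> T \<inter> U = {}}"
      using p c c' by (auto simp: layer_def)
    show "(case case p of (S, T) \<Rightarrow> (card (S - T), S - T, T) of (k, U, T) \<Rightarrow> \<epsilon> ^ (r - k) * cross T U)
        = (case p of (S, T) \<Rightarrow> \<epsilon> ^ card T * cross T (S - T))"
      using p c' by simp
  next
    fix p assume "p \<in> {(k, U, T). k \<le> r \<and> U \<in> layer k \<and> T \<in> layer (r - k) \<and> T \<inter> U = {}}"
    then obtain k U T where p: "p = (k, U, T)" "k \<le> r" "U \<in> layer k" "T \<in> layer (r - k)" "T \<inter> U = {}"
      by auto
    then have fin: "finite U" "finite T" by (auto simp: layer_def finite_sub)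
    have eq: "T \<union> U - T = U" using p by auto
    show "(case case p of (k, U, T) \<Rightarrow> (T \<union> U, T) of (S, T) \<Rightarrow> (card (S - T), S - T, T)) = p"
      using p eq by (simp add: layer_def)
    show "(case p of (k, U, T) \<Rightarrow> (T \<union> U, T)) \<in> (SIGMA S:layer r. Pow S)"
      using p fin by (auto simp: layer_def card_Un_disjoint)
  qed
  \<comment> \<open>The disjointness condition is dropped at no cost, since overlapping pairs have
    cross product zero.\<close>
  also have "\<dots> = (\<Sum>(k, U, T)\<in>(SIGMA k:{..r}. layer k \<times> layer (r - k)). \<epsilon> ^ (r - k) * cross T U)"
  proof (rule sum.mono_neutral_left)
    show "finite (SIGMA k:{..r}. layer k \<times> layer (r - k))" using finite_layer by auto
    show "{(k, U, T). k \<le> r \<and> U \<in> layer k \<and> T \<in> layer (r - k) \<and> T \<inter> U = {}}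
        \<subseteq> (SIGMA k:{..r}. layer k \<times> layer (r - k))" by auto
    have "cross T U = 0" if "U \<in> layer k" "T \<in> layer j" "x \<in> T" "x \<in> U" for j k T U x
      using that cross_nonzero_imp_disjoint[of T U] by (auto simp: layer_def)
    then show "\<forall>p\<in>(SIGMA k:{..r}. layer k \<times> layer (r - k)) -
        {(k, U, T). k \<le> r \<and> U \<in> layer k \<and> T \<in> layer (r - k) \<and> T \<inter> U = {}}.
        (case p of (k, U, T) \<Rightarrow> \<epsilon> ^ (r - k) * cross T U) = 0"
      by auto
  qed
  also have "\<dots>
      = (\<Sum>k\<le>r. \<Sum>(U, T)\<in>layer k \<times> layer (r - k). \<epsilon> ^ (r - k) * cross T U)"
    using finite_layer by (subst sum.Sigma) auto
  also have "\<dots> = (\<Sum>k\<le>r. \<epsilon> ^ (r - k) * cross_sum (r - k) k)"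
    by (intro sum.cong refl)
      (simp add: cross_sum_def sum_distrib_left sum.cartesian_product[symmetric])
  finally show ?thesis by (simp add: \<epsilon>_def)
qed

section \<open>Main term and error terms\<close>

lemma cross_sum_0: "cross_sum t 0 = real (card V choose t)"
proof -
  have "layer 0 = {{}}" using finite_sub by (auto simp: layer_def)
  then show ?thesis by (simp add: cross_sum_def cross_def card_layer)
qed

lemma count_balanced_error:
  assumes "r > 0"
  shows "\<bar>real (card {S. S \<subseteq> V \<and> card S = r \<and> balanced S}) * 2 ^ r - 2 * real (card V choose r)\<bar>
    \<le> (\<Sum>k\<in>{0<..<r}. \<bar>cross_sum (r - k) k\<bar>)"
proof -
  define \<epsilon> :: real where "\<epsilon> = (- 1) ^ (r - 1)"
  \<comment> \<open>The sign of the term \<open>T = S\<close> is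
    \<open>(-1)^(r * (r - 1)) = 1\<close>, so the two extreme terms add up instead of
    cancelling.\<close>
  have "even (r * (r - 1))" by (cases r) auto
  then have \<epsilon>r: "\<epsilon> ^ r = 1" unfolding \<epsilon>_def power_mult[symmetric] by (simp add: minus_one_power_iff)
  have \<epsilon>: "\<bar>\<epsilon>\<bar> = 1" by (simp add: \<epsilon>_def power_abs)
  have "{..r} = insert 0 (insert r {0<..<r})" by auto
  then have "(\<Sum>k\<le>r. \<epsilon> ^ (r - k) * cross_sum (r - k) k)
      = \<epsilon> ^ r * cross_sum r 0 + cross_sum 0 r + (\<Sum>k\<in>{0<..<r}. \<epsilon> ^ (r - k) * cross_sum (r - k) k)"
    using assms by simp
  also have "\<epsilon> ^ r * cross_sum r 0 + cross_sum 0 r = 2 * real (card V choose r)"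
    using cross_sum_0[of r] cross_sum_commute[of 0 r] \<epsilon>r by simp
  finally have "real (card {S. S \<subseteq> V \<and> card S = r \<and> balanced S}) * 2 ^ r - 2 * real (card V choose r)
      = (\<Sum>k\<in>{0<..<r}. \<epsilon> ^ (r - k) * cross_sum (r - k) k)"
    using count_balanced[OF assms] by (simp add: \<epsilon>_def)
  then have "\<bar>real (card {S. S \<subseteq> V \<and> card S = r \<and> balanced S}) * 2 ^ r - 2 * real (card V choose r)\<bar>
      \<le> (\<Sum>k\<in>{0<..<r}. \<bar>\<epsilon> ^ (r - k) * cross_sum (r - k) k\<bar>)"
    by (simp add: sum_abs)
  then show ?thesis by (simp add: abs_mult power_abs \<epsilon>)
qed

text \<open>With the smaller part fixed, the inner sum is at most \<open>(q / (32 * t))^t\<close>,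
  while the number of available \<open>t\<close>-sets is at least \<open>(q / (2 * t))^t\<close>.
  The ratio \<open>16^(-t)\<close> is at most \<open>4^(-(k + t))\<close> because
  \<open>k <= t\<close>.\<close>

lemma cross_sum_bound:
  assumes k: "0 < k" "k \<le> t" and large: "3000000 * (k + t) ^ 2 \<le> card V"
    and char_sum: "\<And>U. U \<subseteq> V \<Longrightarrow> card U = k \<Longrightarrow>
      288 * \<bar>\<Sum>v\<in>V. \<Prod>u\<in>U. a v u\<bar> \<le> real (card V)"
  shows "\<bar>cross_sum t k\<bar> \<le> real ((k + t) choose k) * (1 / 4) ^ (k + t) * real (card V choose (k + t))"
proof -
  define q where "q = card V"
  \<comment> \<open>With this value the character sum contributes at most \<open>t\<close> to the
    exponent, the quadratic term is at most \<open>t\<close> for large \<open>q\<close>, and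
    \<open>exp 2 <= 9\<close> with \<open>288 = 9 * 32\<close> leaves the factor 32.\<close>
  define \<rho> where "\<rho> = 288 * real t / real q"
  have t: "t > 0" using k by simp
  have "(k + t) * 1 \<le> (k + t) * (k + t)" using k by (intro mult_left_mono) auto
  then have big: "3000000 * (k + t) \<le> q" using large unfolding q_def power2_eq_square by linarith
  then have q: "q > 0" using t by simp
  have \<rho>: "\<rho> > 0" using t q by (simp add: \<rho>_def)
  have inner: "\<bar>\<Sum>T\<in>layer t. cross T U\<bar> \<le> (real q / (32 * real t)) ^ t" if U: "U \<in> layer k" for U
  proof -
    define g where "g = (\<lambda>v. \<Prod>u\<in>U. a v u)"
    have UV: "U \<subseteq> V" using U by (simp add: layer_def)
    have g: "g v \<in> {- 1, 0, 1}" if "v \<in> V" for v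
    proof (cases "v \<in> U")
      case True
      then show ?thesis
        using UV finite_sub diag that by (auto simp: g_def intro!: prod_zero)
    next
      case False
      then have "g v \<in> {- 1, 1}" unfolding g_def
        using UV finite_sub off_diag that by (intro prod_sign) auto
      then show ?thesis by auto
    qed
    have "\<bar>\<Sum>T | T \<subseteq> V \<and> card T = t. \<Prod>v\<in>T. g v\<bar> * \<rho> ^ t
        \<le> exp (real q / 2 * \<rho> ^ 2 + \<bar>\<Sum>v\<in>V. g v\<bar> * \<rho>)"
      unfolding q_def using finite_V g \<rho> by (rule elementary_symmetric_sign_bound)
    also have "\<dots> \<le> exp (real t + real t)"
    proof -
      \<comment> \<open>The constant is \<open>288^2 / 2\<close>.\<close>
      have "real q / 2 * \<rho> ^ 2 = real t * (41472 * real t / real q)"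
        using q by (simp add: \<rho>_def field_simps power2_eq_square)
      also have "\<dots> \<le> real t * 1" using big q by (intro mult_left_mono) (simp_all add: divide_le_eq)
      finally have "real q / 2 * \<rho> ^ 2 \<le> real t" by simp
      moreover have "\<bar>\<Sum>v\<in>V. g v\<bar> * \<rho> \<le> real q / 288 * \<rho>"
        using char_sum[of U] U \<rho> by (intro mult_right_mono) (auto simp: layer_def g_def q_def)
      moreover have "real q / 288 * \<rho> = real t" using q by (simp add: \<rho>_def)
      ultimately show ?thesis by simp
    qed
    also have "\<dots> = exp 2 ^ t" by (simp flip: exp_of_nat_mult)
    also have "\<dots> \<le> 9 ^ t"
    proof (rule power_mono)
      have "exp 2 = (exp 1 :: real) ^ 2" by (simp flip: exp_of_nat_mult)
      also have "\<dots> \<le> 3 ^ 2" using exp_le by (intro power_mono) auto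
      finally show "exp 2 \<le> (9 :: real)" by simp
    qed simp
    finally have "\<bar>\<Sum>T | T \<subseteq> V \<and> card T = t. \<Prod>v\<in>T. g v\<bar> \<le> (9 / \<rho>) ^ t"
      using \<rho> by (simp add: power_divide field_simps)
    moreover have "9 / \<rho> = real q / (32 * real t)" by (simp add: \<rho>_def)
    ultimately show ?thesis by (simp add: layer_def cross_def g_def)
  qed
  have "\<bar>cross_sum t k\<bar> \<le> (\<Sum>U\<in>layer k. \<bar>\<Sum>T\<in>layer t. cross T U\<bar>)"
    unfolding cross_sum_def by (rule sum_abs)
  also have "\<dots> \<le> (\<Sum>U\<in>layer k. (real q / (32 * real t)) ^ t)" using inner by (rule sum_mono)
  also have "\<dots> = real (q choose k) * (real q / (32 * real t)) ^ t" by (simp add: card_layer q_def)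
  also have "\<dots> \<le> real (q choose k) * ((1 / 4) ^ (k + t) * real ((q - k) choose t))"
  proof (rule mult_left_mono)
    have "real q / (2 * real t) \<le> real (q - k) / real t"
      using big t by (simp add: field_simps of_nat_diff)
    then have "(real q / (2 * real t)) ^ t \<le> (real (q - k) / real t) ^ t"
      by (rule power_mono) simp
    also have "\<dots> \<le> real ((q - k) choose t)"
      using big by (intro binomial_ge_n_over_k_pow_k) simp
    finally have *: "(real q / (2 * real t)) ^ t \<le> real ((q - k) choose t)" .
    have "(real q / (32 * real t)) ^ t = (1 / 16) ^ t * (real q / (2 * real t)) ^ t"
      by (simp flip: power_mult_distrib)
    also have "(1 / 16 :: real) ^ t = (1 / 4) ^ (t + t)" by (simp add: power_add flip: power_mult_distrib)
    also have "(1 / 4 :: real) ^ (t + t) \<le> (1 / 4) ^ (k + t)" using k by (intro power_decreasing) auto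
    finally show "(real q / (32 * real t)) ^ t \<le> (1 / 4) ^ (k + t) * real ((q - k) choose t)"
      using * by (smt (verit) mult_left_mono zero_le_power zero_le_divide_iff mult_right_mono of_nat_0_le_iff)
  qed simp
  also have "\<dots> = real ((k + t) choose k) * (1 / 4) ^ (k + t) * real (q choose (k + t))"
  proof -
    have "(q choose (k + t)) * ((k + t) choose k) = (q choose k) * ((q - k) choose t)"
      using choose_mult[of k "k + t" q] big by simp
    then have "real (q choose (k + t)) * real ((k + t) choose k) = real (q choose k) * real ((q - k) choose t)"
      by (metis of_nat_mult)
    then show ?thesis by (simp add: mult_ac)
  qed
  finally show ?thesis by (simp add: q_def)
qed

text \<open>By symmetry of \<open>cross_sum\<close> the part held fixed can always be taken of size
  at most \<open>r / 2\<close>, where \<open>char_sum\<close> applies. The binomial weights add up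
  to \<open>2^r\<close>, which turns \<open>4^(-r)\<close> into \<open>2^(-r)\<close>.\<close>

theorem count_balanced_asymptotic:
  assumes r: "r > 0" and large: "3000000 * r ^ 2 \<le> card V"
    and char_sum: "\<And>U. U \<subseteq> V \<Longrightarrow> U \<noteq> {} \<Longrightarrow> 2 * card U \<le> r \<Longrightarrow>
      288 * \<bar>\<Sum>v\<in>V. \<Prod>u\<in>U. a v u\<bar> \<le> real (card V)"
  shows "\<bar>real (card {S. S \<subseteq> V \<and> card S = r \<and> balanced S}) * 2 ^ r - 2 * real (card V choose r)\<bar>
    \<le> (1 / 2) ^ r * real (card V choose r)"
proof -
  have small: "\<bar>cross_sum t k\<bar> \<le> real (r choose k) * (1 / 4) ^ r * real (card V choose r)"
    if kt: "k + t = r" "0 < k" "k \<le> t" for k t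
    unfolding kt(1)[symmetric]
  proof (rule cross_sum_bound)
    fix U assume "U \<subseteq> V" "card U = k"
    then show "288 * \<bar>\<Sum>v\<in>V. \<Prod>u\<in>U. a v u\<bar> \<le> real (card V)"
      using kt by (intro char_sum) auto
  qed (use kt large in simp_all)
  have "\<bar>cross_sum (r - k) k\<bar> \<le> real (r choose k) * (1 / 4) ^ r * real (card V choose r)"
    if "k \<in> {0<..<r}" for k
  proof (cases "k \<le> r - k")
    case True
    then show ?thesis using that small[of k "r - k"] by simp
  next
    case False
    then show ?thesis
      using that small[of "r - k" k] cross_sum_commute[of k "r - k"] by (simp add: binomial_symmetric[of k r])
  qed
  then have "(\<Sum>k\<in>{0<..<r}. \<bar>cross_sum (r - k) k\<bar>)
      \<le> (\<Sum>k\<in>{0<..<r}. real (r choose k) * (1 / 4) ^ r * real (card V choose r))"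
    by (rule sum_mono)
  also have "\<dots> \<le> (\<Sum>k\<le>r. real (r choose k) * (1 / 4) ^ r * real (card V choose r))"
    by (intro sum_mono2) auto
  also have "\<dots> = real (\<Sum>k\<le>r. r choose k) * (1 / 4) ^ r * real (card V choose r)"
    by (simp add: sum_distrib_right)
  also have "\<dots> = (1 / 2) ^ r * real (card V choose r)"
    by (simp add: choose_row_sum flip: power_mult_distrib)
  finally show ?thesis using count_balanced_error[OF r] by linarith
qed

end

section \<open>From field structures to the type class\<close>

definition field_char :: "('a, 'b) ring_scheme \<Rightarrow> 'a \<Rightarrow> int" where
  "field_char F x = (if x = \<zero>\<^bsub>F\<^esub> then 0 else if x \<in> nonzero_squares F then 1 else - 1)"

text \<open>Bundling both facts in one predicate on fields allows a failure of either to be refuted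
  through a single chosen field.\<close>

definition char_facts :: "'a ring \<Rightarrow> bool" where
  "char_facts F \<longleftrightarrow>
    (\<forall>x\<in>carrier F. field_char F (\<ominus>\<^bsub>F\<^esub> x) = field_char F x) \<and>
    (\<forall>U N. U \<subseteq> carrier F \<and> U \<noteq> {} \<and> N > 0 \<and> 12 * N ^ 2 * card U ^ 2 < card (carrier F) \<longrightarrow>
      int N * \<bar>\<Sum>v\<in>carrier F. \<Prod>u\<in>U. field_char F (v \<ominus>\<^bsub>F\<^esub> u)\<bar> \<le> 3 * int (card (carrier F)))"

definition counterexample :: "'a ring \<Rightarrow> bool" where
  "counterexample F \<longleftrightarrow> field F \<and> finite (carrier F) \<and> card (carrier F) mod 4 = 1 \<and> \<not> char_facts F"

definition bool_ring :: "bool ring" where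
  "bool_ring = \<lparr>carrier = UNIV, mult = (\<and>), one = True, zero = False, add = (\<noteq>)\<rparr>"

lemma field_bool_ring: "field bool_ring"
proof (rule cring.cring_fieldI2)
  show "cring bool_ring"
    by (intro cringI abelian_groupI comm_monoidI) (auto simp: bool_ring_def)
qed (auto simp: bool_ring_def)

text \<open>Polynomials over a field are available for type classes only. Hence the hypothetical
  counterexample is turned into a type; the field of two elements serves as a default that makes the type
  definition unconditional.\<close>

definition chosen_field :: "('a + bool) ring" where
  "chosen_field = (if \<exists>F :: 'a ring. counterexample F
     then image_ring Inl (SOME F :: 'a ring. counterexample F) else image_ring Inr bool_ring)"

lemma field_chosen_field: "field (chosen_field :: ('a + bool) ring)"
proof (cases "\<exists>F :: 'a ring. counterexample F")
  case True
  then have "field (SOME F :: 'a ring. counterexample F)"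
    by (metis (mono_tags) someI_ex counterexample_def)
  then show ?thesis
    using True by (simp add: chosen_field_def field.inj_imp_image_ring_is_field)
next
  case False
  then show ?thesis
    using field_bool_ring by (simp add: chosen_field_def field.inj_imp_image_ring_is_field)
qed

lemma finite_chosen_field: "finite (carrier (chosen_field :: ('a + bool) ring))"
proof (cases "\<exists>F :: 'a ring. counterexample F")
  case True
  then have "finite (carrier (SOME F :: 'a ring. counterexample F))"
    by (metis (mono_tags) someI_ex counterexample_def)
  then show ?thesis using True by (simp add: chosen_field_def image_ring_carrier)
qed (simp add: chosen_field_def image_ring_carrier)

section \<open>The chosen field as a type\<close>

typedef 'a chosen = "carrier (chosen_field :: ('a + bool) ring)"
  using abelian_monoid.zero_closed[OF ring.axioms(1)[THEN abelian_group.axioms(1)]]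
    field.is_ring[OF field_chosen_field] by blast

instantiation chosen :: (type) field
begin

definition "0 = Abs_chosen \<zero>\<^bsub>chosen_field\<^esub>"
definition "1 = Abs_chosen \<one>\<^bsub>chosen_field\<^esub>"
definition "x + y = Abs_chosen (Rep_chosen x \<oplus>\<^bsub>chosen_field\<^esub> Rep_chosen y)"
definition "x * y = Abs_chosen (Rep_chosen x \<otimes>\<^bsub>chosen_field\<^esub> Rep_chosen y)"
definition "- x = Abs_chosen (\<ominus>\<^bsub>chosen_field\<^esub> Rep_chosen x)"
definition "x - y = x + - (y :: 'a chosen)"
definition "inverse x = (if x = 0 then 0 else Abs_chosen (inv\<^bsub>chosen_field\<^esub> Rep_chosen x))"
definition "x div y = x * inverse (y :: 'a chosen)"

instance
proof
  fix a b c :: "'a chosen"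
  interpret R: field "chosen_field :: ('a + bool) ring" by (rule field_chosen_field)
  note Rep [simp] = Rep_chosen
  have [simp]: "Rep_chosen (0 :: 'a chosen) = \<zero>\<^bsub>chosen_field\<^esub>" "Rep_chosen (1 :: 'a chosen) = \<one>\<^bsub>chosen_field\<^esub>"
    by (simp_all add: zero_chosen_def one_chosen_def Abs_chosen_inverse)
  have [simp]: "Rep_chosen (x + y) = Rep_chosen x \<oplus>\<^bsub>chosen_field\<^esub> Rep_chosen y"
    "Rep_chosen (x * y) = Rep_chosen x \<otimes>\<^bsub>chosen_field\<^esub> Rep_chosen y"
    "Rep_chosen (- x) = \<ominus>\<^bsub>chosen_field\<^esub> Rep_chosen x" for x y :: "'a chosen"
    by (simp_all add: plus_chosen_def times_chosen_def uminus_chosen_def Abs_chosen_inverse)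
  note inject = Rep_chosen_inject[symmetric]
  show "a + b + c = a + (b + c)" by (simp add: inject R.a_assoc)
  show "a + b = b + a" by (simp add: inject R.a_comm)
  show "0 + a = a" by (simp add: inject)
  show "- a + a = 0" by (simp add: inject R.l_neg)
  show "a - b = a + - b" by (simp add: minus_chosen_def)
  show "a * b * c = a * (b * c)" by (simp add: inject R.m_assoc)
  show "a * b = b * a" by (simp add: inject R.m_comm)
  show "1 * a = a" by (simp add: inject)
  show "(a + b) * c = a * c + b * c" by (simp add: inject R.l_distr)
  show "(0 :: 'a chosen) \<noteq> 1" by (simp add: inject)
  show "inverse a * a = 1" if "a \<noteq> 0"
  proof -
    have "Rep_chosen a \<in> Units chosen_field" using that by (simp add: R.field_Units inject)
    then show ?thesis
      using that by (simp add: inject inverse_chosen_def Abs_chosen_inverse R.Units_inv_closed R.Units_l_inv)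
  qed
  show "a div b = a * inverse b" by (simp add: divide_chosen_def)
  show "inverse (0 :: 'a chosen) = 0" by (simp add: inverse_chosen_def)
qed

end

instance chosen :: (type) finite_field
proof (rule finite_fieldI)
  have *: "(UNIV :: 'a chosen set) = Abs_chosen ` carrier chosen_field"
    using Abs_chosen_cases by blast
  show "finite (UNIV :: 'a chosen set)"
    unfolding * by (rule finite_imageI[OF finite_chosen_field])
qed

lemma counterexample_chosen:
  assumes "\<exists>F :: 'a ring. counterexample F"
  obtains F :: "'a ring" and h :: "'a \<Rightarrow> 'a chosen" where
    "counterexample F" "bij_betw h (carrier F) UNIV" "h \<zero>\<^bsub>F\<^esub> = 0"
    "\<And>x y. x \<in> carrier F \<Longrightarrow> y \<in> carrier F \<Longrightarrow> h (x \<oplus>\<^bsub>F\<^esub> y) = h x + h y"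
    "\<And>x y. x \<in> carrier F \<Longrightarrow> y \<in> carrier F \<Longrightarrow> h (x \<otimes>\<^bsub>F\<^esub> y) = h x * h y"
proof
  define F where "F = (SOME F :: 'a ring. counterexample F)"
  define h :: "'a \<Rightarrow> 'a chosen" where "h = (\<lambda>x. Abs_chosen (Inl x))"
  show "counterexample F" unfolding F_def using assms by (rule someI_ex)
  have eq: "chosen_field = image_ring Inl F" using assms by (simp add: chosen_field_def F_def)
  have in_carrier: "Inl x \<in> carrier chosen_field" if "x \<in> carrier F" for x
    using that by (simp add: eq image_ring_carrier)
  have iso: "(Inl :: 'a \<Rightarrow> 'a + bool) \<in> ring_hom F (image_ring Inl F)"
    using inj_imp_image_ring_iso[of "Inl :: 'a \<Rightarrow> 'a + bool" F] by (simp add: ring_iso_def)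
  show "bij_betw h (carrier F) UNIV"
    unfolding bij_betw_def
  proof
    show "inj_on h (carrier F)"
      using in_carrier by (auto simp: inj_on_def h_def Abs_chosen_inject)
    have "x \<in> h ` carrier F" for x
      by (cases x) (auto simp: h_def eq image_ring_carrier)
    then show "h ` carrier F = UNIV" by auto
  qed
  show "h \<zero>\<^bsub>F\<^esub> = 0" by (simp add: h_def zero_chosen_def eq image_ring_zero)
  show "h (x \<oplus>\<^bsub>F\<^esub> y) = h x + h y" "h (x \<otimes>\<^bsub>F\<^esub> y) = h x * h y"
    if "x \<in> carrier F" "y \<in> carrier F" for x y
    using that in_carrier ring_hom_add[OF iso] ring_hom_mult[OF iso]
    by (simp_all add: h_def plus_chosen_def times_chosen_def Abs_chosen_inverse flip: eq)
qed

theorem char_facts_finite_field: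
  fixes F :: "'a ring"
  assumes "field F" "finite (carrier F)" "card (carrier F) mod 4 = 1"
  shows "char_facts F"
proof (rule ccontr)
  assume "\<not> char_facts F"
  then have "\<exists>F :: 'a ring. counterexample F" using assms by (auto simp: counterexample_def)
  \<comment> \<open>From here \<open>F\<close> is the selected counterexample, not the field of the
    statement. Transporting the type-class results along \<open>h\<close> shows that it satisfies
    \<open>char_facts\<close> after all.\<close>
  then obtain F :: "'a ring" and h :: "'a \<Rightarrow> 'a chosen" where
    F: "counterexample F" and h: "bij_betw h (carrier F) UNIV" and h0: "h \<zero>\<^bsub>F\<^esub> = 0"
    and hadd: "\<And>x y. x \<in> carrier F \<Longrightarrow> y \<in> carrier F \<Longrightarrow> h (x \<oplus>\<^bsub>F\<^esub> y) = h x + h y"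
    and hmult: "\<And>x y. x \<in> carrier F \<Longrightarrow> y \<in> carrier F \<Longrightarrow> h (x \<otimes>\<^bsub>F\<^esub> y) = h x * h y"
    by (rule counterexample_chosen) blast
  interpret R: field F using F by (simp add: counterexample_def)
  have card: "CARD('a chosen) = card (carrier F)" using bij_betw_same_card[OF h] by simp
  have inj: "h x = h y \<longleftrightarrow> x = y" if "x \<in> carrier F" "y \<in> carrier F" for x y
    using h that by (auto simp: bij_betw_def inj_on_def)
  have hminus: "h (\<ominus>\<^bsub>F\<^esub> x) = - h x" if "x \<in> carrier F" for x
    using hadd[of "\<ominus>\<^bsub>F\<^esub> x" x] that h0 by (simp add: R.l_neg eq_neg_iff_add_eq_0)
  have hdiff: "h (x \<ominus>\<^bsub>F\<^esub> y) = h x - h y" if "x \<in> carrier F" "y \<in> carrier F" for x y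
    using that by (simp add: a_minus_def hadd hminus)
  have hsq: "h (z [^]\<^bsub>F\<^esub> (2 :: nat)) = h z ^ 2" if "z \<in> carrier F" for z
    using that hmult[of z z] by (simp add: numeral_2_eq_2)
  have squares: "x \<in> {z [^]\<^bsub>F\<^esub> (2 :: nat) | z. z \<in> carrier F} \<longleftrightarrow> (\<exists>y. h x = y ^ 2)"
    if x: "x \<in> carrier F" for x
  proof
    assume "\<exists>y. h x = y ^ 2"
    then obtain y where y: "h x = y ^ 2" ..
    obtain z where z: "z \<in> carrier F" "h z = y" using h by (metis UNIV_I bij_betw_def imageE)
    then have "x = z [^]\<^bsub>F\<^esub> (2 :: nat)"
      using x y hsq[OF z(1)] inj[of x "z [^]\<^bsub>F\<^esub> (2 :: nat)"] by simp
    then show "x \<in> {z [^]\<^bsub>F\<^esub> (2 :: nat) | z. z \<in> carrier F}" using z by auto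
  qed (use hsq in auto)
  have char: "field_char F x = qchar (h x)" if x: "x \<in> carrier F" for x
    using squares[OF x] inj[OF x R.zero_closed] h0
    unfolding field_char_def qchar_def nonzero_squares_def by auto
  have mod4: "CARD('a chosen) mod 4 = 1" using F card by (simp add: counterexample_def)
  then have odd: "odd CARD('a chosen)" by presburger
  have "char_facts F"
    unfolding char_facts_def
  proof (intro conjI ballI allI impI)
    fix x assume "x \<in> carrier F"
    then show "field_char F (\<ominus>\<^bsub>F\<^esub> x) = field_char F x"
      using qchar_minus[OF mod4] by (simp add: char hminus)
  next
    fix U N assume UN: "U \<subseteq> carrier F \<and> U \<noteq> {} \<and> N > 0 \<and> 12 * N ^ 2 * card U ^ 2 < card (carrier F)"
    have injU: "inj_on h U" using UN h by (auto simp: bij_betw_def intro: inj_on_subset)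
    have "(\<Sum>v\<in>carrier F. \<Prod>u\<in>U. field_char F (v \<ominus>\<^bsub>F\<^esub> u)) = (\<Sum>v\<in>carrier F. \<Prod>u\<in>h ` U. qchar (h v - u))"
    proof (rule sum.cong)
      fix v assume v: "v \<in> carrier F"
      then have "field_char F (v \<ominus>\<^bsub>F\<^esub> u) = qchar (h v - h u)" if "u \<in> U" for u
        using that UN by (subst char) (auto simp: hdiff)
      then show "(\<Prod>u\<in>U. field_char F (v \<ominus>\<^bsub>F\<^esub> u)) = (\<Prod>u\<in>h ` U. qchar (h v - u))"
        by (simp add: prod.reindex[OF injU])
    qed simp
    also have "\<dots> = (\<Sum>v\<in>UNIV. \<Prod>u\<in>h ` U. qchar (v - u))"
      using h by (rule sum.reindex_bij_betw)
    finally show "int N * \<bar>\<Sum>v\<in>carrier F. \<Prod>u\<in>U. field_char F (v \<ominus>\<^bsub>F\<^esub> u)\<bar> \<le> 3 * int (card (carrier F))"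
      using qchar_sum_bound[OF odd, of "h ` U" N] UN by (simp add: card card_image[OF injU])
  qed
  then show False using F by (simp add: counterexample_def)
qed

section \<open>Even induced subgraphs of Paley graphs\<close>

text \<open>Symmetry of the character lets every edge at \<open>v\<close> be oriented as
  \<open>{v, u}\<close> with \<open>v\<close> first, and \<open>u\<close> is determined by the
  edge.\<close>

lemma graph_degree_induced_paley:
  fixes F :: "'a ring"
  assumes F: "field F" and sym: "\<And>x. x \<in> carrier F \<Longrightarrow> field_char F (\<ominus>\<^bsub>F\<^esub> x) = field_char F x"
    and S: "S \<subseteq> carrier F" and v: "v \<in> S"
  shows "graph_degree (induced_subgraph (paley_graph F) S) v = card {u \<in> S. field_char F (v \<ominus>\<^bsub>F\<^esub> u) = 1}"
proof -
  interpret R: field F by (rule F)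
  have char1: "x \<in> nonzero_squares F \<longleftrightarrow> field_char F x = 1" for x
    by (simp add: field_char_def nonzero_squares_def)
  have swap: "field_char F (x \<ominus>\<^bsub>F\<^esub> y) = field_char F (y \<ominus>\<^bsub>F\<^esub> x)" if "x \<in> carrier F" "y \<in> carrier F" for x y
    using sym[of "y \<ominus>\<^bsub>F\<^esub> x"] that by (simp add: R.minus_eq R.minus_add R.a_comm)
  have not_self: "field_char F (x \<ominus>\<^bsub>F\<^esub> x) \<noteq> 1" if "x \<in> carrier F" for x
    using that by (simp add: field_char_def R.minus_eq R.r_neg)
  have "{e \<in> snd (induced_subgraph (paley_graph F) S). v \<in> e}
      = (\<lambda>u. {v, u}) ` {u \<in> S. field_char F (v \<ominus>\<^bsub>F\<^esub> u) = 1}" (is "?L = ?R")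
  proof
    show "?L \<subseteq> ?R"
    proof
      fix e assume "e \<in> ?L"
      then obtain x y where e: "e = {x, y}" "x \<in> S" "y \<in> S" "field_char F (x \<ominus>\<^bsub>F\<^esub> y) = 1" "v = x \<or> v = y"
        by (auto simp: induced_subgraph_def paley_graph_def char1)
      then show "e \<in> ?R" using S swap[of x y] by (auto simp: insert_commute)
    qed
    show "?R \<subseteq> ?L"
      using S v by (auto simp: induced_subgraph_def paley_graph_def char1)
  qed
  moreover have "inj_on (\<lambda>u. {v, u}) {u \<in> S. field_char F (v \<ominus>\<^bsub>F\<^esub> u) = 1}"
    using S v not_self by (auto simp: inj_on_def doubleton_eq_iff)
  ultimately show ?thesis by (simp add: graph_degree_def card_image)
qed

lemma num_even_induced_estimate:
  fixes F :: "'a ring"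
  assumes F: "field F" and q: "card (carrier F) = q" "q mod 4 = 1"
    and r: "r > 0" and large: "3000000 * r ^ 2 \<le> q"
  shows "\<bar>real (num_even_induced F r) * 2 ^ r - 2 * real (q choose r)\<bar> \<le> (1 / 2) ^ r * real (q choose r)"
proof -
  interpret R: field F by (rule F)
  have fin: "finite (carrier F)" using q by (intro card_ge_0_finite) auto
  have facts: "char_facts F" using F fin q by (intro char_facts_finite_field) auto
  then have char_minus: "\<And>x. x \<in> carrier F \<Longrightarrow> field_char F (\<ominus>\<^bsub>F\<^esub> x) = field_char F x"
    by (simp add: char_facts_def)
  define a where "a = (\<lambda>x y. real_of_int (field_char F (x \<ominus>\<^bsub>F\<^esub> y)))"
  interpret sign_matrix "carrier F" a
  proof
    fix x y assume xy: "x \<in> carrier F" "y \<in> carrier F"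
    show "a x y = a y x"
      using char_minus[of "y \<ominus>\<^bsub>F\<^esub> x"] xy by (simp add: a_def R.minus_eq R.minus_add R.a_comm)
    show "a x x = 0" using xy by (simp add: a_def field_char_def R.minus_eq R.r_neg)
    show "a x y \<in> {- 1, 1}" if "x \<noteq> y"
      using that xy R.minus_equality[of x "\<ominus>\<^bsub>F\<^esub> y"] by (auto simp: a_def field_char_def R.minus_eq)
  qed (rule fin)
  have "even_graph (induced_subgraph (paley_graph F) S) \<longleftrightarrow> balanced S" if S: "S \<subseteq> carrier F" for S
  proof -
    have finS: "finite S" using S fin by (rule finite_subset)
    have "even (card {u \<in> S. field_char F (v \<ominus>\<^bsub>F\<^esub> u) = 1})
        \<longleftrightarrow> (\<Prod>u\<in>S - {v}. a v u) = (- 1) ^ (card S - 1)" if v: "v \<in> S" for v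
    proof -
      \<comment> \<open>For \<open>u\<close> other than \<open>v\<close>, the factor
        \<open>- a v u\<close> is -1 exactly when \<open>u\<close> is a neighbour of
        \<open>v\<close>.\<close>
      have "(- 1) ^ card {u \<in> S. field_char F (v \<ominus>\<^bsub>F\<^esub> u) = 1} = (\<Prod>u\<in>S - {v}. - a v u)"
      proof -
        have "(\<Prod>u\<in>S - {v}. - a v u) = (\<Prod>u\<in>S - {v}. if a v u = 1 then - 1 else 1)"
        proof (rule prod.cong)
          fix u assume "u \<in> S - {v}"
          then have "a v u \<in> {- 1, 1}" using S v by (intro off_diag) auto
          then show "- a v u = (if a v u = 1 then - 1 else 1)" by auto
        qed simp
        also have "\<dots> = (\<Prod>u\<in>{u \<in> S - {v}. a v u = 1}. - 1)"
          using finS by (subst prod.inter_filter) auto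
        also have "{u \<in> S - {v}. a v u = 1} = {u \<in> S. field_char F (v \<ominus>\<^bsub>F\<^esub> u) = 1}"
          using diag[of v] S v by (auto simp: a_def)
        finally show ?thesis by simp
      qed
      also have "\<dots> = (- 1) ^ (card S - 1) * (\<Prod>u\<in>S - {v}. a v u)"
        using v finS by (simp add: prod_uminus)
      finally have *: "(- 1) ^ card {u \<in> S. field_char F (v \<ominus>\<^bsub>F\<^esub> u) = 1}
          = (- 1) ^ (card S - 1) * (\<Prod>u\<in>S - {v}. a v u)" .
      have "even (card {u \<in> S. field_char F (v \<ominus>\<^bsub>F\<^esub> u) = 1})
          \<longleftrightarrow> (- 1 :: real) ^ (card S - 1) * (\<Prod>u\<in>S - {v}. a v u) = 1"
        unfolding *[symmetric] by (simp add: minus_one_power_iff)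
      also have "\<dots> \<longleftrightarrow> (\<Prod>u\<in>S - {v}. a v u) = (- 1) ^ (card S - 1)"
        by (auto simp: minus_one_power_iff)
      finally show ?thesis .
    qed
    then show ?thesis
      using graph_degree_induced_paley[OF F char_minus S]
      by (auto simp: even_graph_def balanced_def induced_subgraph_def)
  qed
  then have "num_even_induced F r = card {S. S \<subseteq> carrier F \<and> card S = r \<and> balanced S}"
    unfolding num_even_induced_def by (intro arg_cong[of _ _ card]) auto
  moreover have "288 * \<bar>\<Sum>v\<in>carrier F. \<Prod>u\<in>U. a v u\<bar> \<le> real (card (carrier F))"
    if U: "U \<subseteq> carrier F" "U \<noteq> {}" "2 * card U \<le> r" for U
  proof -
    have "(2 * card U) ^ 2 \<le> r ^ 2" using U by (intro power_mono) auto
    moreover have "r ^ 2 > 0" using r by simp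
    \<comment> \<open>Taking \<open>N = 864 = 3 * 288\<close> yields the required constant 288.
      Since \<open>card U <= r / 2\<close>, the left side is at most \<open>2239488 * r^2\<close>,
      below \<open>3000000 * r^2\<close>.\<close>
    ultimately have "12 * 864 ^ 2 * card U ^ 2 < card (carrier F)"
      using large q by (simp add: power_mult_distrib)
    then have "int 864 * \<bar>\<Sum>v\<in>carrier F. \<Prod>u\<in>U. field_char F (v \<ominus>\<^bsub>F\<^esub> u)\<bar> \<le> 3 * int (card (carrier F))"
      using facts U unfolding char_facts_def by (metis zero_less_numeral of_nat_numeral)
    then have "288 * \<bar>\<Sum>v\<in>carrier F. \<Prod>u\<in>U. field_char F (v \<ominus>\<^bsub>F\<^esub> u)\<bar> \<le> int (card (carrier F))"
      by simp
    then have "real_of_int (288 * \<bar>\<Sum>v\<in>carrier F. \<Prod>u\<in>U. field_char F (v \<ominus>\<^bsub>F\<^esub> u)\<bar>) \<le> real_of_int (int (card (carrier F)))"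
      by (simp only: of_int_le_iff)
    then show ?thesis by (simp add: a_def)
  qed
  ultimately show ?thesis
    using count_balanced_asymptotic[OF r] large q by simp
qed

theorem theorem1p4:
  fixes F :: "nat \<Rightarrow> 'a ring" and r :: "nat \<Rightarrow> nat"
  assumes "\<And>q. q \<in> paley_orders \<Longrightarrow> field (F q)"
    and "\<And>q. q \<in> paley_orders \<Longrightarrow> card (carrier (F q)) = q"
    and "\<And>q. q \<in> paley_orders \<Longrightarrow> r q > 0"
    and "filterlim r at_top paley_at_top"
    and "((\<lambda>q. real (r q) / real q powr (1 / 4)) \<longlongrightarrow> 0) paley_at_top"
  shows "(\<lambda>q. real (num_even_induced (F q) (r q))) \<sim>[paley_at_top]
         (\<lambda>q. 2 powi (1 - int (r q)) * real (q choose r q))"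
proof (rule asymp_equivI')
  have in_orders: "eventually (\<lambda>q. q \<in> paley_orders) paley_at_top"
    unfolding paley_at_top_def by (auto simp: eventually_inf_principal)
  have pos: "eventually (\<lambda>q. q \<ge> (1 :: nat)) paley_at_top"
    unfolding paley_at_top_def eventually_inf_principal
    using eventually_ge_at_top[of "1 :: nat"] by eventually_elim simp
  \<comment> \<open>The threshold gives \<open>r^2 <= q / 4000000\<close> once the quarter power is
    bounded by the square root, enough for the constant 3000000.\<close>
  have "eventually (\<lambda>q. real (r q) / real q powr (1 / 4) < 1 / 2000) paley_at_top"
    using assms(5) by (rule order_tendstoD) simp
  then have large: "eventually (\<lambda>q. 3000000 * r q ^ 2 \<le> q) paley_at_top"
    using pos
  proof eventually_elim
    case (elim q)
    then have "real (r q) \<le> real q powr (1 / 4) / 2000" by (simp add: field_simps)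
    also have "\<dots> \<le> real q powr (1 / 2) / 2000"
      using elim by (intro divide_right_mono powr_mono) auto
    also have "\<dots> = sqrt (real q) / 2000" by (simp add: powr_half_sqrt)
    finally have "real (r q) ^ 2 \<le> (sqrt (real q) / 2000) ^ 2" by (intro power_mono) auto
    then have "3000000 * real (r q) ^ 2 \<le> real q" by (simp add: power_divide)
    then have "real (3000000 * r q ^ 2) \<le> real q" by simp
    then show ?case by (simp only: of_nat_le_iff)
  qed
  \<comment> \<open>The relative error is at most \<open>(1 / 2)^r\<close>, which tends to 0 because
    \<open>r\<close> tends to infinity.\<close>
  have "((\<lambda>n. (1 / 2) ^ n) \<longlongrightarrow> (0 :: real)) at_top" by (rule LIMSEQ_power_zero) simp
  then have half: "((\<lambda>q. (1 / 2) ^ r q) \<longlongrightarrow> (0 :: real)) paley_at_top"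
    using assms(4) by (rule filterlim_compose)
  let ?f = "\<lambda>q. real (num_even_induced (F q) (r q)) / (2 powi (1 - int (r q)) * real (q choose r q))"
  have "((\<lambda>q. ?f q - 1) \<longlongrightarrow> 0) paley_at_top"
  proof (rule tendsto_0_le[OF half])
    show "eventually (\<lambda>q. norm (?f q - 1) \<le> norm ((1 / 2) ^ r q :: real) * 1) paley_at_top"
      using in_orders large
    proof eventually_elim
      case (elim q)
      define N C where "N = real (num_even_induced (F q) (r q))" and "C = real (q choose r q)"
      have rq: "r q > 0" using elim assms(3) by blast
      have "r q * 1 \<le> r q * r q" using rq by (intro mult_left_mono) auto
      \<comment> \<open>This makes the binomial coefficient positive, so the quotient can be
        formed.\<close>
      then have "r q \<le> q" using elim unfolding power2_eq_square by linarith
      then have C: "C > 0" by (simp add: C_def)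
      have "q mod 4 = 1" using elim by (simp add: paley_orders_def cong_def)
      then have est: "\<bar>N * 2 ^ r q - 2 * C\<bar> \<le> (1 / 2) ^ r q * C"
        using num_even_induced_estimate[of "F q" q "r q"] assms(1,2) rq elim by (simp add: N_def C_def)
      have p: "2 powi (1 - int (r q)) = (2 / 2 ^ r q :: real)"
        by (simp add: power_int_diff)
      have "?f q - 1 = (N * 2 ^ r q - 2 * C) / (2 * C)"
        using C unfolding p N_def[symmetric] C_def[symmetric] by (simp add: field_simps)
      then have "norm (?f q - 1) = \<bar>N * 2 ^ r q - 2 * C\<bar> / (2 * C)" using C by simp
      also have "\<dots> \<le> (1 / 2) ^ r q * C / (2 * C)" using C est by (intro divide_right_mono) auto
      also have "\<dots> \<le> (1 / 2) ^ r q" using C by simp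
      finally show ?case by simp
    qed
  qed
  then show "(?f \<longlongrightarrow> 1) paley_at_top" by (simp add: LIM_zero_iff)
qed

end
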